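(* Let $\mathcal{X}\subseteq\mathbb{R}$ be a (nonempty) open interval. For every positive even integer $m$ there exists a key local score function on $\mathcal{X}$ of exact order $m$. For no odd positive integer $m$ does there exist a key local score function on $\mathcal{X}$ of exact order $m$.
   Context: Let $\mathcal{X}\subseteq\mathbb{R}$ be an open interval (possibly unbounded). A $q$-function of order $m$ ($m\ge 0$ an integer) is an infinitely differentiable real-valued function $f(x,q_0,q_1,\ldots,q_m)$ on $\mathcal{X}\times\mathbb{R}^+\times\mathbb{R}^m$, where $x\in\mathcal{X}$, $q_0\in\mathbb{R}^+=(0,\infty)$ and $q_1,\ldots,q_m\in\mathbb{R}$. A $q$-function is a $q$-function of some finite order; a $q$-function of order $m$ is also regarded as one of any order $m'\ge m$ that does not depend on $q_{m+1},\ldots,q_{m'}$. For $m\ge1$, a $q$-function has exact order $m$ if it can be written as a function of $x,q_0,\ldots,q_m$ only, but not as a function of $x,q_0,\ldots,q_{m-1}$ only (equivalently, $\partial f/\partial q_m$ is not identically zero). Operators on $q$-functions (all sums are finite on any given $q$-function): $$D=\frac{\partial}{\partial x}+\sum_{j\ge0}q_{j+1}\frac{\partial}{\partial q_j},\qquad Lf=\sum_{k\ge0}(-1)^{k+1}D^k\Bigl(q_0\frac{\partial f}{\partial q_k}\Bigr).$$ A key local score function is a $q$-function $s$ satisfying the key equation $Ls=0$. *)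

theory Defs
  imports "HOL-Analysis.Analysis"
begin

text \<open>
  A function \<open>f (x, q\<^sub>0, \<dots>, q\<^sub>m)\<close> is represented by \<open>f :: real \<Rightarrow> (nat \<Rightarrow> real) \<Rightarrow> real\<close>
  that on \<open>qdom X\<close> depends only on \<open>x\<close> and the coordinates \<open>q 0, \<dots>, q m\<close>; this makes a
  q-function of order \<open>m\<close> literally one of every order \<open>m' \<ge> m\<close>. Values outside \<open>qdom X\<close>
  are irrelevant: for open \<open>X\<close>, every notion below, evaluated on \<open>qdom X\<close>, depends only on
  the values of \<open>f\<close> on \<open>qdom X\<close>.
\<close>

definition qdom :: "real set \<Rightarrow> (real \<times> (nat \<Rightarrow> real)) set" where
  "qdom X = {(x, q). x \<in> X \<and> 0 < q 0}"

definition pd_x :: "(real \<Rightarrow> (nat \<Rightarrow> real) \<Rightarrow> real) \<Rightarrow> real \<Rightarrow> (nat \<Rightarrow> real) \<Rightarrow> real" where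
  "pd_x f x q = deriv (\<lambda>t. f t q) x"

definition pd_q :: "nat \<Rightarrow> (real \<Rightarrow> (nat \<Rightarrow> real) \<Rightarrow> real) \<Rightarrow> real \<Rightarrow> (nat \<Rightarrow> real) \<Rightarrow> real" where
  "pd_q j f x q = deriv (\<lambda>t. f x (q(j := t))) (q j)"

definition depends_upto :: "real set \<Rightarrow> nat \<Rightarrow> (real \<Rightarrow> (nat \<Rightarrow> real) \<Rightarrow> real) \<Rightarrow> bool" where
  "depends_upto X m f \<longleftrightarrow>
     (\<forall>x q q'. (x, q) \<in> qdom X \<longrightarrow> (x, q') \<in> qdom X \<longrightarrow> (\<forall>j\<le>m. q j = q' j) \<longrightarrow> f x q = f x q')"

text \<open>
  Continuity refers to the product topology on \<open>nat \<Rightarrow> real\<close>; for a function depending only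
  on \<open>x, q 0, \<dots>, q m\<close> it is ordinary joint continuity in these \<open>m + 2\<close> real variables, and
  \<open>Ck_on X n\<close> is ordinary \<open>n\<close>-fold continuous differentiability.
\<close>

fun Ck_on :: "real set \<Rightarrow> nat \<Rightarrow> (real \<Rightarrow> (nat \<Rightarrow> real) \<Rightarrow> real) \<Rightarrow> bool" where
  "Ck_on X 0 f \<longleftrightarrow> continuous_on (qdom X) (\<lambda>(x, q). f x q)"
| "Ck_on X (Suc n) f \<longleftrightarrow>
     (\<forall>(x, q) \<in> qdom X. (\<lambda>t. f t q) field_differentiable at x \<and>
        (\<forall>j. (\<lambda>t. f x (q(j := t))) field_differentiable at (q j))) \<and>
     Ck_on X n (pd_x f) \<and> (\<forall>j. Ck_on X n (pd_q j f))"

definition q_function_of_order :: "real set \<Rightarrow> nat \<Rightarrow> (real \<Rightarrow> (nat \<Rightarrow> real) \<Rightarrow> real) \<Rightarrow> bool" where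
  "q_function_of_order X m f \<longleftrightarrow> depends_upto X m f \<and> (\<forall>n. Ck_on X n f)"

definition q_function :: "real set \<Rightarrow> (real \<Rightarrow> (nat \<Rightarrow> real) \<Rightarrow> real) \<Rightarrow> bool" where
  "q_function X f \<longleftrightarrow> (\<exists>m. q_function_of_order X m f)"

definition exact_order :: "real set \<Rightarrow> nat \<Rightarrow> (real \<Rightarrow> (nat \<Rightarrow> real) \<Rightarrow> real) \<Rightarrow> bool" where
  "exact_order X m f \<longleftrightarrow> 1 \<le> m \<and> q_function_of_order X m f \<and> \<not> depends_upto X (m - 1) f"

text \<open>
  For a q-function of order \<open>m\<close>, at points of \<open>qdom X\<close>, the terms of both series with index
  above \<open>m\<close> vanish, so the series are finite sums.
\<close>

definition total_D :: "(real \<Rightarrow> (nat \<Rightarrow> real) \<Rightarrow> real) \<Rightarrow> real \<Rightarrow> (nat \<Rightarrow> real) \<Rightarrow> real" where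
  "total_D f x q = pd_x f x q + (\<Sum>j. q (Suc j) * pd_q j f x q)"

definition key_L :: "(real \<Rightarrow> (nat \<Rightarrow> real) \<Rightarrow> real) \<Rightarrow> real \<Rightarrow> (nat \<Rightarrow> real) \<Rightarrow> real" where
  "key_L f x q =
     (\<Sum>k. (-1) ^ (k + 1) * (total_D ^^ k) (\<lambda>y r. r 0 * pd_q k f y r) x q)"

definition key_local_score :: "real set \<Rightarrow> (real \<Rightarrow> (nat \<Rightarrow> real) \<Rightarrow> real) \<Rightarrow> bool" where
  "key_local_score X s \<longleftrightarrow> q_function X s \<and> (\<forall>(x, q) \<in> qdom X. key_L s x q = 0)"

end

theory Submission
  imports Defs "HOL-Library.Function_Algebras"
begin

text \<open>
  Write \<open>\<Lambda> f = \<Sum>k. (-D)^k (\<partial>f/\<partial>q\<^sub>k)\<close> for the Euler operator of the calculus of variations.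
  The product rule gives \<open>L s = s - \<Lambda> (q\<^sub>0 s)\<close>, so the key equation says \<open>\<Lambda> (q\<^sub>0 s) = s\<close>. In
  particular a key local score is an Euler-Lagrange expression, and the theorem reflects two
  properties of such expressions. Both come from the evolutionary derivation
  \<open>E\<^sub>v f = \<Sum>j. D^j v \<partial>f/\<partial>q\<^sub>j\<close> attached to a q-function \<open>v\<close>: integration by parts gives
  \<open>E\<^sub>v f = v \<Lambda> f + D g\<close> for some \<open>g\<close> (lemma \<open>evol_by_parts\<close>), and \<open>\<Lambda>\<close> annihilates total
  derivatives (lemma \<open>Euler_totD\<close>). The latter, like the commutation of \<open>E\<^sub>v\<close> with \<open>D\<close>, rests on
  \<open>\<partial>\<^sub>j D = D \<partial>\<^sub>j + \<partial>\<^sub>j\<^sub>-\<^sub>1\<close>, hence on the symmetry of second partial derivatives.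

  Odd orders. If \<open>v\<close> depends on \<open>x\<close> alone, \<open>E\<^sub>v\<close> commutes with \<open>\<Lambda>\<close>, so for \<open>s = \<Lambda> \<psi>\<close>
  one gets \<open>E\<^sub>v s = \<Lambda> (E\<^sub>v \<psi>) = \<Lambda> (v s)\<close> (lemma \<open>evol_Euler_self_adjoint\<close>): the linearisation of
  \<open>s\<close> is formally self-adjoint. For \<open>s\<close> of order \<open>m\<close>, take \<open>v = (x - a)^m\<close> and evaluate at
  \<open>x = a\<close>: only the top coefficient survives, and \<open>s\<^sub>m = (-1)^m s\<^sub>m\<close> for \<open>s\<^sub>m = \<partial>s/\<partial>q\<^sub>m\<close>. Thus
  \<open>s\<^sub>m = 0\<close> if \<open>m\<close> is odd (lemma \<open>Euler_top_symbol\<close>).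

  Even orders. For \<open>v = q\<^sub>0\<close> one has \<open>D^j v = q\<^sub>j\<close>, so \<open>E\<^sub>v \<phi> = \<phi>\<close> is Euler's relation for \<open>\<phi>\<close>
  homogeneous of degree one in \<open>(q\<^sub>0, q\<^sub>1, \<dots>)\<close>. Then \<open>\<phi>\<close> and \<open>q\<^sub>0 \<Lambda> \<phi>\<close> differ by a total derivative,
  whence \<open>\<Lambda> (q\<^sub>0 \<Lambda> \<phi>) = \<Lambda> \<phi>\<close> and \<open>s = \<Lambda> \<phi>\<close> solves the key equation (lemma
  \<open>Euler_homogeneous\<close>). The choice \<open>\<phi> = q\<^sub>n\<^sup>2 / q\<^sub>0\<close> yields \<open>\<partial>s/\<partial>q\<^sub>2\<^sub>n = \<plusminus> 2 / q\<^sub>0\<close>, so \<open>s\<close> has exact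
  order \<open>2 n\<close>; for \<open>n = 1\<close> it is a constant multiple of Hyvarinen's score.
\<close>

section \<open>Symmetry of mixed partial derivatives\<close>

text \<open>
  Two applications of the mean value theorem to the second difference over a square. Exchanging
  the roles of the two variables expresses the same number through the other mixed partial
  derivative, which is how symmetry follows below.
\<close>

lemma double_difference_mean_value:
  fixes g :: "real \<Rightarrow> real \<Rightarrow> real"
  assumes h: "0 < h" "h < e"
    and d1: "\<And>s t. \<bar>s - a\<bar> < e \<Longrightarrow> \<bar>t - b\<bar> < e \<Longrightarrow> ((\<lambda>s. g s t) has_field_derivative gs s t) (at s)"
    and d12: "\<And>s t. \<bar>s - a\<bar> < e \<Longrightarrow> \<bar>t - b\<bar> < e \<Longrightarrow> (gs s has_field_derivative gst s t) (at t)"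
  obtains \<xi> \<eta> where "a < \<xi>" "\<xi> < a + h" "b < \<eta>" "\<eta> < b + h"
    "g (a + h) (b + h) - g (a + h) b - g a (b + h) + g a b = h * h * gst \<xi> \<eta>"
proof -
  have "\<exists>\<xi>>a. \<xi> < a + h \<and> (g (a+h) (b+h) - g (a+h) b) - (g a (b+h) - g a b)
          = (a + h - a) * (gs \<xi> (b+h) - gs \<xi> b)"
    by (rule MVT2) (use h in \<open>auto intro!: DERIV_diff d1\<close>)
  then obtain \<xi> where \<xi>: "a < \<xi>" "\<xi> < a + h"
    "(g (a+h) (b+h) - g (a+h) b) - (g a (b+h) - g a b) = h * (gs \<xi> (b+h) - gs \<xi> b)"
    by auto
  have "\<exists>\<eta>>b. \<eta> < b + h \<and> gs \<xi> (b+h) - gs \<xi> b = (b + h - b) * gst \<xi> \<eta>"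
    by (rule MVT2) (use h \<xi> in \<open>auto intro!: d12\<close>)
  then obtain \<eta> where "b < \<eta>" "\<eta> < b + h" "gs \<xi> (b+h) - gs \<xi> b = h * gst \<xi> \<eta>"
    by auto
  with \<xi> show thesis by (intro that[of \<xi> \<eta>]) auto
qed

lemma mixed_partials_eq:
  fixes g :: "real \<Rightarrow> real \<Rightarrow> real"
  assumes e: "0 < e"
    and d1: "\<And>s t. \<bar>s - a\<bar> < e \<Longrightarrow> \<bar>t - b\<bar> < e \<Longrightarrow> ((\<lambda>s. g s t) has_field_derivative gs s t) (at s)"
    and d2: "\<And>s t. \<bar>s - a\<bar> < e \<Longrightarrow> \<bar>t - b\<bar> < e \<Longrightarrow> (g s has_field_derivative gt s t) (at t)"
    and d12: "\<And>s t. \<bar>s - a\<bar> < e \<Longrightarrow> \<bar>t - b\<bar> < e \<Longrightarrow> (gs s has_field_derivative gst s t) (at t)"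
    and d21: "\<And>s t. \<bar>s - a\<bar> < e \<Longrightarrow> \<bar>t - b\<bar> < e \<Longrightarrow> ((\<lambda>s. gt s t) has_field_derivative gts s t) (at s)"
    and c12: "isCont (\<lambda>z. gst (fst z) (snd z)) (a, b)"
    and c21: "isCont (\<lambda>z. gts (fst z) (snd z)) (a, b)"
  shows "gst a b = gts a b"
proof (rule ccontr)
  assume ne: "gst a b \<noteq> gts a b"
  define \<epsilon> where "\<epsilon> = \<bar>gst a b - gts a b\<bar> / 2"
  have \<epsilon>: "0 < \<epsilon>" using ne by (simp add: \<epsilon>_def)
  obtain \<delta>1 where \<delta>1: "0 < \<delta>1" "\<And>z. dist z (a, b) < \<delta>1 \<Longrightarrow> dist (gst (fst z) (snd z)) (gst a b) < \<epsilon>"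
    using c12 \<epsilon> unfolding continuous_at_eps_delta by fastforce
  obtain \<delta>2 where \<delta>2: "0 < \<delta>2" "\<And>z. dist z (a, b) < \<delta>2 \<Longrightarrow> dist (gts (fst z) (snd z)) (gts a b) < \<epsilon>"
    using c21 \<epsilon> unfolding continuous_at_eps_delta by fastforce
  define h where "h = min (e / 2) (min (\<delta>1 / 2) (\<delta>2 / 2))"
  have h: "0 < h" "h < e" "2 * h \<le> \<delta>1" "2 * h \<le> \<delta>2"
    using e \<delta>1 \<delta>2 by (auto simp: h_def)
  have near: "dist (s, t) (a, b) < 2 * h" if "a < s" "s < a + h" "b < t" "t < b + h" for s t
  proof -
    have "dist (s, t) (a, b) \<le> \<bar>s - a\<bar> + \<bar>t - b\<bar>"
      unfolding dist_prod_def dist_real_def by (simp add: sqrt_sum_squares_le_sum_abs)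
    then show ?thesis using that by auto
  qed
  obtain s t where st: "a < s" "s < a + h" "b < t" "t < b + h"
    "g (a + h) (b + h) - g (a + h) b - g a (b + h) + g a b = h * h * gst s t"
    by (rule double_difference_mean_value[OF h(1,2) d1 d12])
  obtain t' s' where st': "b < t'" "t' < b + h" "a < s'" "s' < a + h"
    "g (a + h) (b + h) - g a (b + h) - g (a + h) b + g a b = h * h * gts s' t'"
    by (rule double_difference_mean_value[where g = "\<lambda>t s. g s t" and gs = "\<lambda>t s. gt s t"
          and gst = "\<lambda>t s. gts s t" and e = e and a = b and b = a, OF h(1,2)])
       (use d2 d21 in auto)
  have "h * h * gst s t = h * h * gts s' t'" using st(5) st'(5) by linarith
  then have eq: "gst s t = gts s' t'" using h by simp
  have "dist (gst s t) (gst a b) < \<epsilon>"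
    using \<delta>1(2)[of "(s, t)"] near[of s t] st h by simp
  moreover have "dist (gts s' t') (gts a b) < \<epsilon>"
    using \<delta>2(2)[of "(s', t')"] near[of s' t'] st' h by simp
  ultimately show False using eq ne unfolding \<epsilon>_def dist_real_def by (auto simp: abs_if split: if_splits)
qed

section \<open>Coordinates of the jet space\<close>

type_synonym jet = "real \<times> (nat \<Rightarrow> real)"

text \<open>
  The variable \<open>x\<close> has index \<open>None\<close> and \<open>q\<^sub>j\<close> has index \<open>Some j\<close>, so that smoothness and the
  symmetry of mixed partial derivatives need only one argument for all variables.
\<close>

fun coord :: "nat option \<Rightarrow> jet \<Rightarrow> real" where
  "coord None p = fst p"
| "coord (Some j) p = snd p j"

fun set_coord :: "nat option \<Rightarrow> real \<Rightarrow> jet \<Rightarrow> jet" where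
  "set_coord None t p = (t, snd p)"
| "set_coord (Some j) t p = (fst p, (snd p)(j := t))"

definition partial :: "nat option \<Rightarrow> (jet \<Rightarrow> real) \<Rightarrow> jet \<Rightarrow> real" where
  "partial c F p = deriv (\<lambda>t. F (set_coord c t p)) (coord c p)"

lemma set_coord_coord [simp]: "set_coord c (coord c p) p = p"
  by (cases c) auto

lemma coord_set_coord: "coord c (set_coord c' t p) = (if c = c' then t else coord c p)"
  by (cases c; cases c') auto

lemma set_coord_same [simp]: "set_coord c s (set_coord c t p) = set_coord c s p"
  by (cases c) auto

lemma set_coord_commute: "c \<noteq> c' \<Longrightarrow> set_coord c s (set_coord c' t p) = set_coord c' t (set_coord c s p)"
  by (cases c; cases c') (auto simp: fun_upd_twist)

lemma continuous_on_jet: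
  assumes "\<And>c. continuous_on S (\<lambda>z. coord c (h z))"
  shows "continuous_on S h"
proof -
  have 1: "continuous_on S (\<lambda>z. fst (h z))" using assms[of None] by simp
  have "continuous_on S (\<lambda>z. snd (h z) j)" for j using assms[of "Some j"] by simp
  then have 2: "continuous_on S (\<lambda>z. snd (h z))" by (rule continuous_on_coordinatewise_then_product)
  show ?thesis using continuous_on_Pair[OF 1 2] by simp
qed

lemma continuous_on_coord: "continuous_on S (coord c)"
proof (cases c)
  case None
  then have "coord c = fst" by auto
  then show ?thesis by (simp add: continuous_on_fst continuous_on_id)
next
  case (Some j)
  have "continuous_on S (\<lambda>p. snd p j :: real)"
    by (rule continuous_on_product_then_coordinatewise) (rule continuous_on_snd, rule continuous_on_id)
  moreover have "coord c = (\<lambda>p. snd p j)" using Some by auto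
  ultimately show ?thesis by simp
qed

lemma open_qdom:
  assumes "open X"
  shows "open (qdom X)"
proof -
  have "qdom X = X \<times> {q. 0 < q 0}" by (auto simp: qdom_def)
  moreover have "open {q :: nat \<Rightarrow> real. 0 < q 0}"
    by (intro open_Collect_less continuous_on_const continuous_on_product_coordinates)
  ultimately show ?thesis using assms by (simp add: open_Times)
qed

section \<open>The ring of q-functions\<close>

text \<open>Quantified jets stay whole, so that \<open>coord\<close> and \<open>set_coord\<close> can act on them.\<close>

declare split_paired_All [simp del] split_paired_Ex [simp del]

locale jets =
  fixes X :: "real set"
  assumes open_X: "open X"
begin

abbreviation J :: "jet set" where "J \<equiv> qdom X"

lemma open_J: "open J"
  by (rule open_qdom[OF open_X])

lemma eventually_set_coord_in:
  assumes "p \<in> J"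
  shows "eventually (\<lambda>t. set_coord c t p \<in> J) (nhds (coord c p))"
proof -
  have "continuous_on UNIV (\<lambda>t. set_coord c t p)"
  proof (rule continuous_on_jet)
    fix d show "continuous_on UNIV (\<lambda>t. coord d (set_coord c t p))"
      by (cases "d = c") (auto simp: coord_set_coord intro: continuous_on_id)
  qed
  then have "open ((\<lambda>t. set_coord c t p) -` J)"
    using open_J by (rule open_vimage[rotated])
  then show ?thesis
    using assms eventually_nhds_in_open[of "(\<lambda>t. set_coord c t p) -` J" "coord c p"] by simp
qed

text \<open>
  Unlike \<^const>\<open>Ck_on\<close>, this hierarchy demands continuity at every level, which makes it decreasing
  in the level and therefore closed under products: the product rule at level \<open>n + 1\<close> needs the
  factors themselves, not only their derivatives, at level \<open>n\<close>.
\<close>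

primrec Cn :: "nat \<Rightarrow> (jet \<Rightarrow> real) \<Rightarrow> bool" where
  "Cn 0 = (\<lambda>F. continuous_on J F)"
| "Cn (Suc n) = (\<lambda>F. continuous_on J F \<and>
     (\<forall>c. \<forall>p\<in>J. (\<lambda>t. F (set_coord c t p)) field_differentiable at (coord c p)) \<and>
     (\<forall>c. Cn n (partial c F)))"

lemma Cn_continuous: "Cn n F \<Longrightarrow> continuous_on J F"
  by (cases n) auto

lemma has_partial:
  assumes "Cn (Suc n) F" "p \<in> J"
  shows "((\<lambda>t. F (set_coord c t p)) has_field_derivative partial c F p) (at (coord c p))"
  using assms by (auto simp: partial_def DERIV_deriv_iff_field_differentiable)

lemma eventually_eq_set_coord:
  assumes "\<And>p. p \<in> J \<Longrightarrow> F p = G p" "p \<in> J"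
  shows "eventually (\<lambda>t. F (set_coord c t p) = G (set_coord c t p)) (nhds (coord c p))"
  using eventually_set_coord_in[OF assms(2)] by eventually_elim (rule assms(1))

lemma partial_cong:
  assumes "\<And>p. p \<in> J \<Longrightarrow> F p = G p" "p \<in> J"
  shows "partial c F p = partial c G p"
  unfolding partial_def using eventually_eq_set_coord[OF assms] by (intro deriv_cong_ev) auto

lemma Cn_cong:
  assumes "\<And>p. p \<in> J \<Longrightarrow> F p = G p" "Cn n F"
  shows "Cn n G"
  using assms
proof (induction n arbitrary: F G)
  case 0
  then show ?case using continuous_on_cong[OF refl, of J F G] by simp
next
  case (Suc n)
  have "continuous_on J G"
    using continuous_on_cong[OF refl, of J F G] Suc.prems Cn_continuous by blast
  moreover have "(\<lambda>t. G (set_coord c t p)) field_differentiable at (coord c p)" if "p \<in> J" for c p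
  proof -
    have "((\<lambda>t. G (set_coord c t p)) has_field_derivative partial c F p) (at (coord c p))"
      using has_partial[OF Suc.prems(2) that, of c] eventually_eq_set_coord[OF Suc.prems(1) that]
        DERIV_cong_ev[OF refl] by fastforce
    then show ?thesis by (auto simp: field_differentiable_def)
  qed
  moreover have "Cn n (partial c G)" for c
    by (rule Suc.IH[of "partial c F"]) (use Suc.prems partial_cong[OF Suc.prems(1)] in auto)
  ultimately show ?case by simp
qed

lemma partial_eqI:
  assumes "((\<lambda>t. F (set_coord c t p)) has_field_derivative D) (at (coord c p))"
  shows "partial c F p = D"
  unfolding partial_def by (rule DERIV_imp_deriv[OF assms])

lemma Cn_SucI:
  assumes "continuous_on J F"
    and "\<And>c p. p \<in> J \<Longrightarrow> ((\<lambda>t. F (set_coord c t p)) has_field_derivative G c p) (at (coord c p))"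
    and "\<And>c. Cn n (G c)"
  shows "Cn (Suc n) F"
proof -
  have "Cn n (partial c F)" for c
    by (rule Cn_cong[OF _ assms(3)[of c]]) (use partial_eqI[OF assms(2)] in auto)
  moreover have "(\<lambda>t. F (set_coord c t p)) field_differentiable at (coord c p)" if "p \<in> J" for c p
    using assms(2)[OF that] unfolding field_differentiable_def by blast
  ultimately show ?thesis using assms(1) by simp
qed

lemma Cn_Suc_imp: "Cn (Suc n) F \<Longrightarrow> Cn n F"
  by (induction n arbitrary: F) (auto simp del: Cn.simps(2) simp: Cn.simps(2))

lemma Cn_const: "Cn n (\<lambda>_. a)"
proof (induction n arbitrary: a)
  case (Suc n)
  show ?case by (rule Cn_SucI[where G = "\<lambda>_ _. 0"]) (use Suc in auto)
qed auto

lemma has_partial_coord: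
  "((\<lambda>t. coord c' (set_coord c t p)) has_field_derivative (if c = c' then 1 else 0)) (at (coord c p))"
  by (cases "c = c'") (auto simp: coord_set_coord)

lemma Cn_coord: "Cn n (coord c)"
proof (cases n)
  case (Suc n)
  show ?thesis unfolding Suc
    by (rule Cn_SucI[OF continuous_on_coord has_partial_coord]) (rule Cn_const)
qed (simp add: continuous_on_coord)

lemma Cn_add: "Cn n F \<Longrightarrow> Cn n G \<Longrightarrow> Cn n (F + G)"
proof (induction n arbitrary: F G)
  case (Suc n)
  show ?case
  proof (rule Cn_SucI)
    show "continuous_on J (F + G)"
      unfolding plus_fun_def by (intro continuous_on_add Cn_continuous[OF Suc.prems(1)] Cn_continuous[OF Suc.prems(2)])
    show "((\<lambda>t. (F + G) (set_coord c t p)) has_field_derivative (partial c F + partial c G) p) (at (coord c p))"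
      if "p \<in> J" for c p
      unfolding plus_fun_apply
      by (intro DERIV_add has_partial[OF Suc.prems(1) that] has_partial[OF Suc.prems(2) that])
    show "Cn n (partial c F + partial c G)" for c
      by (rule Suc.IH) (use Suc.prems in simp_all)
  qed
qed (auto simp: plus_fun_def intro: continuous_on_add)

lemma Cn_mult: "Cn n F \<Longrightarrow> Cn n G \<Longrightarrow> Cn n (F * G)"
proof (induction n arbitrary: F G)
  case (Suc n)
  show ?case
  proof (rule Cn_SucI)
    show "continuous_on J (F * G)"
      unfolding times_fun_def by (intro continuous_on_mult Cn_continuous[OF Suc.prems(1)] Cn_continuous[OF Suc.prems(2)])
    show "((\<lambda>t. (F * G) (set_coord c t p)) has_field_derivative (partial c F * G + F * partial c G) p) (at (coord c p))"
      if "p \<in> J" for c p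
      using DERIV_mult[OF has_partial[OF Suc.prems(1) that, of c] has_partial[OF Suc.prems(2) that, of c]]
      by (simp add: mult.commute)
    show "Cn n (partial c F * G + F * partial c G)" for c
      by (intro Cn_add Suc.IH Cn_Suc_imp[OF Suc.prems(1)] Cn_Suc_imp[OF Suc.prems(2)])
         (use Suc.prems in simp_all)
  qed
qed (auto simp: times_fun_def intro: continuous_on_mult)

lemma Cn_uminus: "Cn n F \<Longrightarrow> Cn n (- F)"
  using Cn_mult[OF Cn_const[of n "-1"], of F] by (simp add: times_fun_def fun_Compl_def)

lemma q0_pos: "p \<in> J \<Longrightarrow> 0 < snd p 0"
  by (auto simp: qdom_def)

lemma has_partial_inverse_q0:
  assumes "p \<in> J"
  shows "((\<lambda>t. inverse (snd (set_coord c t p) 0)) has_field_derivative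
           (if c = Some 0 then - (inverse (snd p 0) * inverse (snd p 0)) else 0)) (at (coord c p))"
proof (cases "c = Some 0")
  case True
  have "((\<lambda>t. inverse t) has_field_derivative - (inverse (snd p 0) * inverse (snd p 0))) (at (snd p 0))"
    using DERIV_inverse[of "snd p 0" UNIV] q0_pos[OF assms] by (simp add: power2_eq_square)
  then show ?thesis using True by simp
next
  case False
  then have "(\<lambda>t. inverse (snd (set_coord c t p) 0)) = (\<lambda>t. inverse (snd p 0))" by (cases c) auto
  then show ?thesis using False by simp
qed

lemma Cn_inverse_q0: "Cn n (\<lambda>p. inverse (snd p 0))"
proof (induction n)
  case 0
  have "continuous_on J (\<lambda>p. inverse (coord (Some 0) p))"
    by (rule continuous_on_inverse[OF continuous_on_coord]) (use q0_pos in force)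
  then show ?case by simp
next
  case (Suc n)
  show ?case
  proof (rule Cn_SucI)
    show "continuous_on J (\<lambda>p. inverse (snd p 0))" by (rule Cn_continuous[OF Suc])
    show "Cn n (\<lambda>p. if c = Some 0 then - (inverse (snd p 0) * inverse (snd p 0)) else 0)" for c
      using Cn_uminus[OF Cn_mult[OF Suc Suc]] Cn_const[of n 0]
      by (cases "c = Some 0") (simp_all add: times_fun_def fun_Compl_def)
  qed (rule has_partial_inverse_q0)
qed

definition dep :: "nat \<Rightarrow> (jet \<Rightarrow> real) \<Rightarrow> bool" where
  "dep m F \<longleftrightarrow> (\<forall>p\<in>J. \<forall>q\<in>J. fst p = fst q \<longrightarrow> (\<forall>j\<le>m. snd p j = snd q j) \<longrightarrow> F p = F q)"

lemma partial_above_dep: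
  assumes "dep m F" "p \<in> J" "m < j"
  shows "partial (Some j) F p = 0"
proof -
  have "eventually (\<lambda>t. F (set_coord (Some j) t p) = F p) (nhds (coord (Some j) p))"
    using eventually_set_coord_in[OF assms(2)]
  proof eventually_elim
    case (elim t)
    show ?case
      by (rule assms(1)[unfolded dep_def, rule_format, OF elim assms(2)]) (use assms(3) in auto)
  qed
  then show ?thesis
    unfolding partial_def by (subst deriv_cong_ev[of _ "\<lambda>_. F p"]) auto
qed

lemma dep_partial:
  assumes "dep m F"
  shows "dep m (partial c F)"
  unfolding dep_def
proof (intro ballI impI)
  fix p q assume pq: "p \<in> J" "q \<in> J" "fst p = fst q" "\<forall>j\<le>m. snd p j = snd q j"
  show "partial c F p = partial c F q"
  proof (cases "\<exists>j>m. c = Some j")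
    case True
    then obtain j where "m < j" "c = Some j" by blast
    then show ?thesis using partial_above_dep[OF assms] pq(1,2) by simp
  next
    case False
    then have c: "coord c p = coord c q" using pq by (cases c) (auto simp: not_less)
    have "eventually (\<lambda>t. set_coord c t q \<in> J) (nhds (coord c p))"
      using eventually_set_coord_in[OF pq(2)] c by simp
    then have "eventually (\<lambda>t. F (set_coord c t p) = F (set_coord c t q)) (nhds (coord c p))"
      using eventually_set_coord_in[OF pq(1)]
    proof eventually_elim
      case (elim t)
      show ?case
        by (rule assms[unfolded dep_def, rule_format, OF elim(2,1)]) (use pq in \<open>cases c; auto\<close>)+
    qed
    then show ?thesis unfolding partial_def using c by (intro deriv_cong_ev) auto
  qed
qed

lemma dep_mono: "dep m F \<Longrightarrow> m \<le> n \<Longrightarrow> dep n F"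
  unfolding dep_def by (meson order_trans)

text \<open>
  Functions are normalised to vanish off \<open>J\<close>, so that equality on \<open>J\<close> becomes equality and
  the ring and operator identities can be used by plain rewriting.
\<close>

definition res :: "(jet \<Rightarrow> real) \<Rightarrow> jet \<Rightarrow> real" where
  "res F p = (if p \<in> J then F p else 0)"

definition Q :: "nat \<Rightarrow> (jet \<Rightarrow> real) set" where
  "Q m = {F. (\<forall>p. p \<notin> J \<longrightarrow> F p = 0) \<and> dep m F \<and> (\<forall>n. Cn n F)}"

definition QQ :: "(jet \<Rightarrow> real) set" where
  "QQ = (\<Union>m. Q m)"

definition pd :: "nat option \<Rightarrow> (jet \<Rightarrow> real) \<Rightarrow> jet \<Rightarrow> real" where
  "pd c F = res (partial c F)"

abbreviation dq :: "nat \<Rightarrow> (jet \<Rightarrow> real) \<Rightarrow> jet \<Rightarrow> real" where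
  "dq j \<equiv> pd (Some j)"

definition const :: "real \<Rightarrow> jet \<Rightarrow> real" where
  "const a = res (\<lambda>_. a)"

definition var :: "nat option \<Rightarrow> jet \<Rightarrow> real" where
  "var c = res (coord c)"

definition inv_q0 :: "jet \<Rightarrow> real" where
  "inv_q0 = res (\<lambda>p. inverse (snd p 0))"

lemma res_in [simp]: "p \<in> J \<Longrightarrow> res F p = F p"
  and res_out [simp]: "p \<notin> J \<Longrightarrow> res F p = 0"
  by (auto simp: res_def)

lemma Q_I: "(\<And>p. p \<notin> J \<Longrightarrow> F p = 0) \<Longrightarrow> dep m F \<Longrightarrow> (\<And>n. Cn n F) \<Longrightarrow> F \<in> Q m"
  by (simp add: Q_def)

lemma res_in_Q:
  assumes "dep m F" "\<And>n. Cn n F"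
  shows "res F \<in> Q m"
proof (rule Q_I)
  show "dep m (res F)"
    unfolding dep_def
  proof (intro ballI impI)
    fix p q assume "p \<in> J" "q \<in> J" "fst p = fst q" "\<forall>j\<le>m. snd p j = snd q j"
    moreover from this have "F p = F q" using assms(1) unfolding dep_def by blast
    ultimately show "res F p = res F q" by simp
  qed
  show "Cn n (res F)" for n by (rule Cn_cong[OF _ assms(2)]) simp
qed simp

lemma Q_out: "F \<in> Q m \<Longrightarrow> p \<notin> J \<Longrightarrow> F p = 0"
  and Q_dep: "F \<in> Q m \<Longrightarrow> dep m F"
  and Q_Cn: "F \<in> Q m \<Longrightarrow> Cn n F"
  by (auto simp: Q_def)

lemma Q_mono: "F \<in> Q m \<Longrightarrow> m \<le> n \<Longrightarrow> F \<in> Q n"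
  by (auto simp: Q_def dep_mono)

lemma Q_QQ: "F \<in> Q m \<Longrightarrow> F \<in> QQ"
  by (auto simp: QQ_def)

lemma QQ_out: "F \<in> QQ \<Longrightarrow> p \<notin> J \<Longrightarrow> F p = 0"
  using Q_out[of F _ p] by (auto simp: QQ_def)

lemma QQ_common:
  assumes "F \<in> QQ" "G \<in> QQ"
  obtains m where "F \<in> Q m" "G \<in> Q m"
proof -
  obtain a b where "F \<in> Q a" "G \<in> Q b" using assms by (auto simp: QQ_def)
  then have "F \<in> Q (max a b)" "G \<in> Q (max a b)"
    using Q_mono[of F a "max a b"] Q_mono[of G b "max a b"] by simp_all
  then show thesis by (rule that)
qed

lemma dep_binary:
  assumes "dep m F" "dep m G"
  shows "dep m (\<lambda>p. h (F p) (G p))"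
  unfolding dep_def
proof (intro ballI impI)
  fix p q assume "p \<in> J" "q \<in> J" "fst p = fst q" "\<forall>j\<le>m. snd p j = snd q j"
  then have "F p = F q" "G p = G q"
    using assms unfolding dep_def by blast+
  then show "h (F p) (G p) = h (F q) (G q)" by simp
qed

lemma Q_0 [simp]: "0 \<in> Q m"
proof (rule Q_I)
  show "Cn n 0" for n using Cn_const[of n 0] unfolding zero_fun_def .
qed (simp_all add: dep_def)

lemma Q_add:
  assumes "F \<in> Q m" "G \<in> Q m"
  shows "F + G \<in> Q m"
proof (rule Q_I)
  show "(F + G) p = 0" if "p \<notin> J" for p
    using that Q_out[OF assms(1), of p] Q_out[OF assms(2), of p] by simp
  show "dep m (F + G)"
    using dep_binary[OF Q_dep[OF assms(1)] Q_dep[OF assms(2)], of "(+)"] by (simp add: plus_fun_def)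
  show "Cn n (F + G)" for n
    by (rule Cn_add[OF Q_Cn[OF assms(1)] Q_Cn[OF assms(2)]])
qed

lemma Q_mult:
  assumes "F \<in> Q m" "G \<in> Q m"
  shows "F * G \<in> Q m"
proof (rule Q_I)
  show "(F * G) p = 0" if "p \<notin> J" for p
    using that Q_out[OF assms(1), of p] Q_out[OF assms(2), of p] by simp
  show "dep m (F * G)"
    using dep_binary[OF Q_dep[OF assms(1)] Q_dep[OF assms(2)], of "(*)"] by (simp add: times_fun_def)
  show "Cn n (F * G)" for n
    by (rule Cn_mult[OF Q_Cn[OF assms(1)] Q_Cn[OF assms(2)]])
qed

lemma Q_uminus:
  assumes "F \<in> Q m"
  shows "- F \<in> Q m"
proof (rule Q_I)
  show "(- F) p = 0" if "p \<notin> J" for p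
    using that Q_out[OF assms, of p] by simp
  show "dep m (- F)"
    using dep_binary[OF Q_dep[OF assms] Q_dep[OF assms], of "\<lambda>a _. - a"] by (simp add: fun_Compl_def)
  show "Cn n (- F)" for n
    by (rule Cn_uminus[OF Q_Cn[OF assms]])
qed

lemma Q_sum: "(\<And>i. i \<in> A \<Longrightarrow> F i \<in> Q m) \<Longrightarrow> sum F A \<in> Q m"
  by (induction A rule: infinite_finite_induct) (auto intro: Q_add)

lemma QQ_0 [simp]: "0 \<in> QQ"
  using Q_0 Q_QQ by blast

lemma QQ_add [intro, simp]: "F \<in> QQ \<Longrightarrow> G \<in> QQ \<Longrightarrow> F + G \<in> QQ"
  by (meson QQ_common Q_QQ Q_add)

lemma QQ_mult [intro, simp]: "F \<in> QQ \<Longrightarrow> G \<in> QQ \<Longrightarrow> F * G \<in> QQ"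
  by (meson QQ_common Q_QQ Q_mult)

lemma QQ_uminus [intro, simp]: "F \<in> QQ \<Longrightarrow> - F \<in> QQ"
  unfolding QQ_def using Q_uminus by blast

lemma QQ_sum: "(\<And>i. i \<in> A \<Longrightarrow> F i \<in> QQ) \<Longrightarrow> sum F A \<in> QQ"
  by (induction A rule: infinite_finite_induct) auto

lemma const_Q [simp]: "const a \<in> Q m"
  unfolding const_def by (intro res_in_Q Cn_const) (auto simp: dep_def)

lemma var_Q: "var (Some j) \<in> Q j" "var None \<in> Q m"
  unfolding var_def by (intro res_in_Q Cn_coord; auto simp: dep_def)+

lemma var_QQ [simp]: "var c \<in> QQ"
  by (cases c) (use var_Q Q_QQ in blast)+

lemma const_QQ [simp]: "const a \<in> QQ"
  using const_Q Q_QQ by blast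

lemma inv_q0_Q [simp]: "inv_q0 \<in> Q m"
  unfolding inv_q0_def by (intro res_in_Q Cn_inverse_q0) (auto simp: dep_def)

lemma const_1_mult [simp]:
  assumes "F \<in> QQ"
  shows "const 1 * F = F" "F * const 1 = F"
proof -
  have "const 1 p * F p = F p" for p
    using QQ_out[OF assms, of p] by (cases "p \<in> J") (simp_all add: const_def)
  then show *: "const 1 * F = F" unfolding times_fun_def by (rule ext)
  show "F * const 1 = F" unfolding mult.commute[of F] by (rule *)
qed

subsection \<open>Partial derivatives\<close>

lemma pd_Q:
  assumes "F \<in> Q m"
  shows "pd c F \<in> Q m"
  unfolding pd_def
proof (rule res_in_Q)
  show "Cn n (partial c F)" for n using Q_Cn[OF assms, of "Suc n"] by simp
qed (rule dep_partial[OF Q_dep[OF assms]])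

lemma pd_QQ [intro, simp]: "F \<in> QQ \<Longrightarrow> pd c F \<in> QQ"
  using pd_Q[of F _ c] by (auto simp: QQ_def)

lemma has_pd:
  assumes "F \<in> QQ" "p \<in> J"
  shows "((\<lambda>t. F (set_coord c t p)) has_field_derivative pd c F p) (at (coord c p))"
proof -
  obtain m where "F \<in> Q m" using assms(1) by (auto simp: QQ_def)
  from has_partial[OF Q_Cn[OF this] assms(2)] show ?thesis using assms(2) by (simp add: pd_def)
qed

lemma pd_eqI:
  assumes "\<And>p. p \<in> J \<Longrightarrow> ((\<lambda>t. F (set_coord c t p)) has_field_derivative G p) (at (coord c p))"
    and "\<And>p. p \<notin> J \<Longrightarrow> G p = 0"
  shows "pd c F = G"
proof
  fix p show "pd c F p = G p"
    using partial_eqI[OF assms(1), of p] assms(2)[of p] by (cases "p \<in> J") (simp_all add: pd_def)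
qed

lemma pd_res:
  assumes "\<And>p. p \<in> J \<Longrightarrow> F p = G p"
  shows "pd c F = pd c G"
proof
  show "pd c F p = pd c G p" for p
    using partial_cong[where F = F and G = G and p = p and c = c, OF assms] by (cases "p \<in> J") (simp_all add: pd_def)
qed

lemma pd_above:
  assumes "F \<in> Q m" "m < j"
  shows "dq j F = 0"
proof
  show "dq j F p = 0 p" for p
    using partial_above_dep[OF Q_dep[OF assms(1)] _ assms(2), of p]
    by (cases "p \<in> J") (simp_all add: pd_def)
qed

lemma pd_out: "p \<notin> J \<Longrightarrow> pd c F p = 0"
  by (simp add: pd_def)

lemma pd_add:
  assumes "F \<in> QQ" "G \<in> QQ"
  shows "pd c (F + G) = pd c F + pd c G"
proof (rule pd_eqI)
  fix p assume p: "p \<in> J"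
  show "((\<lambda>t. (F + G) (set_coord c t p)) has_field_derivative (pd c F + pd c G) p) (at (coord c p))"
    using DERIV_add[OF has_pd[OF assms(1) p, of c] has_pd[OF assms(2) p, of c]] by simp
qed (simp add: pd_out)

lemma pd_mult:
  assumes "F \<in> QQ" "G \<in> QQ"
  shows "pd c (F * G) = pd c F * G + F * pd c G"
proof (rule pd_eqI)
  fix p assume p: "p \<in> J"
  show "((\<lambda>t. (F * G) (set_coord c t p)) has_field_derivative (pd c F * G + F * pd c G) p) (at (coord c p))"
    using DERIV_mult[OF has_pd[OF assms(1) p, of c] has_pd[OF assms(2) p, of c]] by (simp add: mult.commute)
qed (simp add: pd_out QQ_out[OF assms(1)] QQ_out[OF assms(2)])

lemma pd_uminus:
  assumes "F \<in> QQ"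
  shows "pd c (- F) = - pd c F"
proof (rule pd_eqI)
  fix p assume p: "p \<in> J"
  show "((\<lambda>t. (- F) (set_coord c t p)) has_field_derivative (- pd c F) p) (at (coord c p))"
    using DERIV_minus[OF has_pd[OF assms p, of c]] by simp
qed (simp add: pd_out)

lemma pd_0 [simp]: "pd c 0 = 0"
  by (rule pd_eqI) auto

lemma pd_sum: "(\<And>i. i \<in> A \<Longrightarrow> F i \<in> QQ) \<Longrightarrow> pd c (sum F A) = (\<Sum>i\<in>A. pd c (F i))"
  by (induction A rule: infinite_finite_induct) (auto simp: pd_add QQ_sum)

lemma pd_const [simp]: "pd c (const a) = 0"
  unfolding const_def pd_res[of "res (\<lambda>_. a)" "\<lambda>_. a", simplified] by (rule pd_eqI) auto

lemma pd_var: "pd c (var c') = (if c = c' then const 1 else 0)"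
proof -
  have "pd c (var c') = pd c (coord c')" by (rule pd_res) (simp add: var_def)
  also have "\<dots> = (if c = c' then const 1 else 0)"
  proof (rule pd_eqI)
    fix p assume "p \<in> J"
    then have "(if c = c' then const 1 else 0) p = (if c = c' then 1 else (0::real))" by (simp add: const_def)
    then show "((\<lambda>t. coord c' (set_coord c t p)) has_field_derivative (if c = c' then const 1 else 0) p) (at (coord c p))"
      using has_partial_coord[of c' c p] by simp
  qed (auto simp: const_def)
  finally show ?thesis .
qed

lemma pd_inv_q0: "pd c inv_q0 = (if c = Some 0 then - (inv_q0 * inv_q0) else 0)"
proof -
  have "pd c inv_q0 = pd c (\<lambda>p. inverse (snd p 0))" by (rule pd_res) (simp add: inv_q0_def)
  also have "\<dots> = (if c = Some 0 then - (inv_q0 * inv_q0) else 0)"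
  proof (rule pd_eqI)
    fix p assume p: "p \<in> J"
    show "((\<lambda>t. inverse (snd (set_coord c t p) 0)) has_field_derivative
        (if c = Some 0 then - (inv_q0 * inv_q0) else 0) p) (at (coord c p))"
      using has_partial_inverse_q0[OF p, of c] p by (auto simp: inv_q0_def split: if_splits)
  qed (auto simp: inv_q0_def)
  finally show ?thesis .
qed

text \<open>
  All coordinates but two are fixed. Continuity of \<open>\<sigma>\<close> into the product topology both
  provides a small square mapped into the open set \<open>J\<close> and transfers continuity of the second
  derivatives to the plane.
\<close>

lemma pd_commute:
  assumes F: "F \<in> QQ"
  shows "pd c (pd c' F) = pd c' (pd c F)"
proof (cases "c = c'")
  case False
  show ?thesis
  proof
    fix p
    show "pd c (pd c' F) p = pd c' (pd c F) p"
    proof (cases "p \<in> J")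
      case True
      define \<sigma> where "\<sigma> z = set_coord c (fst z) (set_coord c' (snd z) p)" for z
      let ?a = "coord c p" and ?b = "coord c' p"
      have \<sigma>_cont: "continuous_on UNIV \<sigma>"
      proof (rule continuous_on_jet)
        fix d
        have eq: "(\<lambda>z. coord d (\<sigma> z)) = (if d = c then fst else if d = c' then snd else (\<lambda>_. coord d p))"
          by (auto simp: \<sigma>_def coord_set_coord)
        show "continuous_on UNIV (\<lambda>z. coord d (\<sigma> z))"
          unfolding eq by (simp add: continuous_on_fst continuous_on_snd continuous_on_id)
      qed
      have ab: "\<sigma> (?a, ?b) = p" by (simp add: \<sigma>_def)
      have "open (\<sigma> -` J)" using \<sigma>_cont open_J by (rule open_vimage[rotated])
      then obtain e where e: "0 < e" "ball (?a, ?b) e \<subseteq> \<sigma> -` J"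
        using True ab open_contains_ball[of "\<sigma> -` J"] by force
      have inJ: "\<sigma> (s, t) \<in> J" if "\<bar>s - ?a\<bar> < e / 2" "\<bar>t - ?b\<bar> < e / 2" for s t
      proof -
        have "dist (s, t) (?a, ?b) \<le> \<bar>s - ?a\<bar> + \<bar>t - ?b\<bar>"
          unfolding dist_prod_def dist_real_def by (simp add: sqrt_sum_squares_le_sum_abs)
        then have "(s, t) \<in> ball (?a, ?b) e" using that by (simp add: dist_commute)
        then show ?thesis using e by auto
      qed
      have d1: "((\<lambda>s. G (\<sigma> (s, t))) has_field_derivative pd c G (\<sigma> (s, t))) (at s)"
        if "G \<in> QQ" "\<bar>s - ?a\<bar> < e / 2" "\<bar>t - ?b\<bar> < e / 2" for G s t
        using has_pd[OF that(1) inJ[OF that(2,3)], of c] False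
        by (simp add: \<sigma>_def coord_set_coord)
      have d2: "((\<lambda>t. G (\<sigma> (s, t))) has_field_derivative pd c' G (\<sigma> (s, t))) (at t)"
        if "G \<in> QQ" "\<bar>s - ?a\<bar> < e / 2" "\<bar>t - ?b\<bar> < e / 2" for G s t
        using has_pd[OF that(1) inJ[OF that(2,3)], of c'] False
        by (simp add: \<sigma>_def coord_set_coord set_coord_commute[of c c'])
      have cont: "isCont (\<lambda>z. G (\<sigma> z)) (?a, ?b)" if "G \<in> QQ" for G
      proof -
        have "continuous_on J G" using that by (auto simp: QQ_def intro: Cn_continuous Q_Cn)
        then have "isCont G (\<sigma> (?a, ?b))"
          using open_J True ab by (simp add: continuous_on_eq_continuous_at)
        then show ?thesis
          using \<sigma>_cont isCont_o2[of "(?a, ?b)" \<sigma> G] by (simp add: continuous_on_eq_continuous_at)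
      qed
      have "pd c' (pd c F) (\<sigma> (?a, ?b)) = pd c (pd c' F) (\<sigma> (?a, ?b))"
        by (rule mixed_partials_eq[where e = "e / 2" and g = "\<lambda>s t. F (\<sigma> (s, t))"
              and gs = "\<lambda>s t. pd c F (\<sigma> (s, t))" and gt = "\<lambda>s t. pd c' F (\<sigma> (s, t))"
              and gst = "\<lambda>s t. pd c' (pd c F) (\<sigma> (s, t))" and gts = "\<lambda>s t. pd c (pd c' F) (\<sigma> (s, t))"])
           (use e F in \<open>auto intro!: d1 d2 cont\<close>)
      then show ?thesis using ab by simp
    qed (simp add: pd_def)
  qed
qed simp

end

text \<open>
  From here on functions are elements of a ring. The pointwise rules are switched off, because
  rewriting with them under a binder destroys the algebraic form of the arguments of operators.
\<close>

lemmas pointwise = plus_fun_apply zero_fun_apply times_fun_apply one_fun_apply uminus_apply minus_apply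

declare pointwise [simp del]

lemma sum_apply: "sum f A p = (\<Sum>i\<in>A. f i p)"
  for f :: "'i \<Rightarrow> 'a \<Rightarrow> real"
  by (induction A rule: infinite_finite_induct) (simp_all add: pointwise)

context jets
begin

section \<open>The total derivative\<close>

text \<open>
  Summing over the nonzero partial derivatives makes the sum finite on every q-function without
  committing to an order; \<open>sum_dq_truncate\<close> recovers the sum up to any order of the function.
\<close>

definition totD :: "(jet \<Rightarrow> real) \<Rightarrow> jet \<Rightarrow> real" where
  "totD F = pd None F + (\<Sum>j | dq j F \<noteq> 0. var (Some (Suc j)) * dq j F)"

text \<open>
  The formal adjoint of \<open>totD\<close>; working with its powers keeps the signs \<open>(-1)^k\<close> out of the
  calculations.
\<close>

definition adjD :: "(jet \<Rightarrow> real) \<Rightarrow> jet \<Rightarrow> real" where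
  "adjD F = - totD F"

lemma sum_dq_truncate:
  assumes "F \<in> Q m" and "\<And>j. dq j F = 0 \<Longrightarrow> h j = 0"
  shows "(\<Sum>j | dq j F \<noteq> 0. h j) = (\<Sum>j\<le>m. h j)"
proof (rule sum.mono_neutral_left)
  show "{j. dq j F \<noteq> 0} \<subseteq> {..m}" using pd_above[OF assms(1)] by (auto simp: not_less[symmetric])
qed (use assms(2) in auto)

lemma totD_eq:
  assumes "F \<in> Q m"
  shows "totD F = pd None F + (\<Sum>j\<le>m. var (Some (Suc j)) * dq j F)"
  unfolding totD_def by (subst sum_dq_truncate[OF assms]) auto

lemma totD_Q:
  assumes "F \<in> Q m"
  shows "totD F \<in> Q (Suc m)"
  unfolding totD_eq[OF assms]
proof (intro Q_add Q_sum Q_mult)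
  show "pd None F \<in> Q (Suc m)" by (rule Q_mono[OF pd_Q[OF assms]]) simp
  show "dq j F \<in> Q (Suc m)" for j by (rule Q_mono[OF pd_Q[OF assms]]) simp
  show "var (Some (Suc j)) \<in> Q (Suc m)" if "j \<in> {..m}" for j
    by (rule Q_mono[OF var_Q(1)]) (use that in auto)
qed

lemma totD_QQ [intro, simp]: "F \<in> QQ \<Longrightarrow> totD F \<in> QQ"
  using totD_Q by (auto simp: QQ_def)

lemma adjD_QQ [intro, simp]: "F \<in> QQ \<Longrightarrow> adjD F \<in> QQ"
  by (simp add: adjD_def QQ_uminus)

lemma totD_pow_QQ [intro, simp]: "F \<in> QQ \<Longrightarrow> (totD ^^ k) F \<in> QQ"
  by (induction k) auto

lemma adjD_pow_QQ [intro, simp]: "F \<in> QQ \<Longrightarrow> (adjD ^^ k) F \<in> QQ"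
  by (induction k) auto

lemma totD_add:
  assumes "F \<in> QQ" "G \<in> QQ"
  shows "totD (F + G) = totD F + totD G"
proof -
  obtain m where m: "F \<in> Q m" "G \<in> Q m" using QQ_common[OF assms] .
  show ?thesis
    by (simp add: totD_eq[OF m(1)] totD_eq[OF m(2)] totD_eq[OF Q_add[OF m]] pd_add[OF assms]
        algebra_simps sum.distrib)
qed

lemma totD_mult:
  assumes "F \<in> QQ" "G \<in> QQ"
  shows "totD (F * G) = totD F * G + F * totD G"
proof -
  obtain m where m: "F \<in> Q m" "G \<in> Q m" using QQ_common[OF assms] .
  show ?thesis
    by (simp add: totD_eq[OF m(1)] totD_eq[OF m(2)] totD_eq[OF Q_mult[OF m]] pd_mult[OF assms]
        algebra_simps sum.distrib sum_distrib_left)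
qed

lemma totD_uminus: "F \<in> QQ \<Longrightarrow> totD (- F) = - totD F"
  by (auto simp: QQ_def totD_eq[of F] totD_eq[OF Q_uminus] pd_uminus[OF Q_QQ] sum_negf)

lemma totD_0 [simp]: "totD 0 = 0"
  by (simp add: totD_eq[OF Q_0[of 0]])

lemma totD_sum: "(\<And>i. i \<in> A \<Longrightarrow> F i \<in> QQ) \<Longrightarrow> totD (sum F A) = (\<Sum>i\<in>A. totD (F i))"
  by (induction A rule: infinite_finite_induct) (auto simp: totD_add QQ_sum)

lemma adjD_add: "F \<in> QQ \<Longrightarrow> G \<in> QQ \<Longrightarrow> adjD (F + G) = adjD F + adjD G"
  by (simp add: adjD_def totD_add)

lemma adjD_0 [simp]: "adjD 0 = 0"
  unfolding adjD_def totD_0 by (rule minus_zero)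

lemma adjD_pow_0 [simp]: "(adjD ^^ k) 0 = 0"
proof (induction k)
  case (Suc k)
  then show ?case by simp
qed simp

lemma adjD_pow_add: "F \<in> QQ \<Longrightarrow> G \<in> QQ \<Longrightarrow> (adjD ^^ k) (F + G) = (adjD ^^ k) F + (adjD ^^ k) G"
proof (induction k)
  case (Suc k)
  then show ?case by (simp add: adjD_add)
qed simp

lemma adjD_pow_sign:
  assumes "F \<in> QQ"
  shows "(adjD ^^ k) F = (if even k then (totD ^^ k) F else - (totD ^^ k) F)"
proof (induction k)
  case (Suc k)
  then show ?case
    using assms by (simp add: adjD_def totD_uminus)
qed simp

lemma adjD_pow_Q: "F \<in> Q m \<Longrightarrow> (adjD ^^ k) F \<in> Q (m + k)"
  by (induction k) (auto simp: adjD_def intro: Q_uminus totD_Q)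

text \<open>
  The only coefficient of \<open>totD\<close> that involves \<open>q\<^sub>j\<close> is that of \<open>\<partial>/\<partial>q\<^sub>j\<^sub>-\<^sub>1\<close>; it produces the extra
  term.
\<close>

lemma dq_totD:
  assumes "F \<in> QQ"
  shows "dq j (totD F) = totD (dq j F) + (case j of 0 \<Rightarrow> 0 | Suc i \<Rightarrow> dq i F)"
proof -
  obtain m where m: "F \<in> Q m" using assms by (auto simp: QQ_def)
  have index_shift: "(\<Sum>i\<le>m. dq j (var (Some (Suc i))) * dq i F) = (case j of 0 \<Rightarrow> 0 | Suc i \<Rightarrow> dq i F)"
  proof (cases j)
    case (Suc k)
    have "(\<Sum>i\<le>m. dq j (var (Some (Suc i))) * dq i F) = (\<Sum>i\<le>m. if k = i then dq i F else 0)"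
      by (rule sum.cong) (use Suc assms in \<open>auto simp: pd_var\<close>)
    also have "\<dots> = dq k F"
      using pd_above[OF m, of k] by (auto simp: sum.delta' not_le)
    finally show ?thesis using Suc by simp
  qed (simp add: pd_var)
  have "dq j (totD F) = pd None (dq j F)
      + (\<Sum>i\<le>m. dq j (var (Some (Suc i))) * dq i F + var (Some (Suc i)) * dq i (dq j F))"
    unfolding totD_eq[OF m]
    using assms
    by (simp add: pd_add pd_sum pd_mult QQ_sum QQ_mult pd_commute[OF assms, of "Some j"])
  also have "\<dots> = totD (dq j F) + (case j of 0 \<Rightarrow> 0 | Suc i \<Rightarrow> dq i F)"
    by (simp add: sum.distrib index_shift totD_eq[OF pd_Q[OF m]] add_ac)
  finally show ?thesis .
qed

section \<open>The Euler operator and evolutionary derivations\<close>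

text \<open>
  \<open>Euler F\<close> is the variational derivative of the functional with density \<open>F\<close>, and \<open>evol v F\<close> the
  first variation of \<open>F\<close> along \<open>v\<close>: the derivative of \<open>F\<close> when \<open>q\<^sub>j\<close> varies at the speed \<open>D^j v\<close>.
\<close>

definition Euler :: "(jet \<Rightarrow> real) \<Rightarrow> jet \<Rightarrow> real" where
  "Euler F = (\<Sum>k | dq k F \<noteq> 0. (adjD ^^ k) (dq k F))"

definition evol :: "(jet \<Rightarrow> real) \<Rightarrow> (jet \<Rightarrow> real) \<Rightarrow> jet \<Rightarrow> real" where
  "evol v F = (\<Sum>j | dq j F \<noteq> 0. (totD ^^ j) v * dq j F)"

lemma Euler_eq:
  assumes "F \<in> Q m"
  shows "Euler F = (\<Sum>k\<le>m. (adjD ^^ k) (dq k F))"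
  unfolding Euler_def by (rule sum_dq_truncate[OF assms]) simp

lemma evol_eq:
  assumes "F \<in> Q m"
  shows "evol v F = (\<Sum>j\<le>m. (totD ^^ j) v * dq j F)"
  unfolding evol_def by (rule sum_dq_truncate[OF assms]) simp

lemma Euler_QQ [simp]: "F \<in> QQ \<Longrightarrow> Euler F \<in> QQ"
  by (auto simp: Euler_def intro!: QQ_sum)

lemma evol_QQ [simp]: "F \<in> QQ \<Longrightarrow> v \<in> QQ \<Longrightarrow> evol v F \<in> QQ"
  by (auto simp: evol_def intro!: QQ_sum)

lemma Euler_add:
  assumes "F \<in> QQ" "G \<in> QQ"
  shows "Euler (F + G) = Euler F + Euler G"
proof -
  obtain m where m: "F \<in> Q m" "G \<in> Q m" using QQ_common[OF assms] .
  show ?thesis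
    using assms by (simp add: Euler_eq[OF m(1)] Euler_eq[OF m(2)] Euler_eq[OF Q_add[OF m]] pd_add adjD_pow_add sum.distrib)
qed

text \<open>
  By \<open>dq_totD\<close> the \<open>k\<close>-th summand is \<open>a k - a (k + 1)\<close> with \<open>a (k + 1) = (-D)^(k+1) (\<partial>F/\<partial>q\<^sub>k)\<close>, so the sum
  telescopes; the last term vanishes once the order of \<open>F\<close> is exceeded.
\<close>

lemma Euler_totD:
  assumes "F \<in> QQ"
  shows "Euler (totD F) = 0"
proof -
  obtain m where m: "F \<in> Q m" using assms by (auto simp: QQ_def)
  define a where "a k = (adjD ^^ k) (case k of 0 \<Rightarrow> 0 | Suc i \<Rightarrow> dq i F)" for k
  have "(adjD ^^ k) (dq k (totD F)) = a k - a (Suc k)" for k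
  proof -
    have "(adjD ^^ k) (totD (dq k F)) = - a (Suc k)"
    proof -
      have "a (Suc k) = (adjD ^^ k) (- totD (dq k F))"
        by (simp only: a_def funpow_Suc_right o_apply nat.case adjD_def)
      moreover have "(adjD ^^ k) (- totD (dq k F)) + (adjD ^^ k) (totD (dq k F)) = 0"
        using assms adjD_pow_add[of "- totD (dq k F)" "totD (dq k F)" k] by (simp add: QQ_uminus)
      ultimately show ?thesis by (simp add: eq_neg_iff_add_eq_0 add.commute)
    qed
    moreover have "(case k of 0 \<Rightarrow> 0 | Suc i \<Rightarrow> dq i F) \<in> QQ" using assms by (auto split: nat.split)
    ultimately show ?thesis
      using assms unfolding dq_totD[OF assms] by (simp add: adjD_pow_add a_def)
  qed
  then have "Euler (totD F) = (\<Sum>k\<le>Suc m. a k - a (Suc k))"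
    using Euler_eq[OF totD_Q[OF m]] by simp
  also have "\<dots> = a 0 - a (Suc (Suc m))" by (rule sum_telescope)
  also have "\<dots> = 0" using pd_above[OF m, of "Suc m"] by (simp add: a_def del: funpow.simps)
  finally show ?thesis .
qed

lemma by_parts:
  assumes "A \<in> QQ" "B \<in> QQ"
  shows "\<exists>G\<in>QQ. (totD ^^ k) A * B = A * (adjD ^^ k) B + totD G"
  using assms(2)
proof (induction k arbitrary: B)
  case 0
  show ?case by (rule bexI[of _ 0]) auto
next
  case (Suc k)
  obtain G where G: "G \<in> QQ" "(totD ^^ k) A * adjD B = A * (adjD ^^ k) (adjD B) + totD G"
    using Suc.IH[OF adjD_QQ[OF Suc.prems]] by blast
  have "totD ((totD ^^ k) A * B) = (totD ^^ Suc k) A * B - (totD ^^ k) A * adjD B"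
    using assms Suc.prems by (simp add: totD_mult adjD_def)
  then have "(totD ^^ Suc k) A * B = A * (adjD ^^ Suc k) B + totD (G + (totD ^^ k) A * B)"
    using G assms Suc.prems by (simp add: totD_add QQ_mult funpow_swap1 algebra_simps)
  then show ?case
    by (rule bexI[of _ "G + (totD ^^ k) A * B"]) (use G assms Suc.prems in auto)
qed

lemma evol_by_parts:
  assumes "v \<in> QQ" "F \<in> QQ"
  obtains G where "G \<in> QQ" "evol v F = v * Euler F + totD G"
proof -
  have "\<exists>G. \<forall>j. G j \<in> QQ \<and> (totD ^^ j) v * dq j F = v * (adjD ^^ j) (dq j F) + totD (G j)"
    using by_parts[OF assms(1) pd_QQ[OF assms(2)]] by (intro choice) blast
  then obtain G where G: "\<And>j. G j \<in> QQ"
    "\<And>j. (totD ^^ j) v * dq j F = v * (adjD ^^ j) (dq j F) + totD (G j)" by blast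
  let ?S = "{j. dq j F \<noteq> 0}"
  have "evol v F = v * Euler F + totD (sum G ?S)"
    unfolding evol_def Euler_def by (simp add: G sum.distrib totD_sum sum_distrib_left)
  moreover have "sum G ?S \<in> QQ" using G by (intro QQ_sum)
  ultimately show thesis using that by blast
qed

text \<open>
  \<open>F\<close> and \<open>v * Euler F\<close> differ by a total derivative, so they have the same image under \<open>Euler\<close>.
\<close>

lemma Euler_homogeneous:
  assumes "v \<in> QQ" "F \<in> QQ" "evol v F = F"
  shows "Euler (v * Euler F) = Euler F"
proof -
  obtain G where G: "G \<in> QQ" "evol v F = v * Euler F + totD G" using evol_by_parts assms by blast
  then have "F = v * Euler F + totD G" using assms(3) by simp
  then have "Euler F = Euler (v * Euler F + totD G)" by (rule arg_cong)
  also have "\<dots> = Euler (v * Euler F)" using G(1) assms(1,2) by (simp add: Euler_add Euler_totD)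
  finally show ?thesis ..
qed

text \<open>
  The extra terms \<open>D^j v \<partial>F/\<partial>q\<^sub>j\<^sub>-\<^sub>1\<close> on the left are, after an index shift, the terms
  \<open>D (D^j v) \<partial>F/\<partial>q\<^sub>j\<close> that the product rule creates on the right.
\<close>

lemma evol_totD:
  assumes "v \<in> QQ" "F \<in> QQ"
  shows "evol v (totD F) = totD (evol v F)"
proof -
  obtain m where m: "F \<in> Q m" using assms by (auto simp: QQ_def)
  have top: "dq (Suc m) F = 0" using pd_above[OF m] by simp
  have "evol v (totD F) = (\<Sum>j\<le>Suc m. (totD ^^ j) v * totD (dq j F))
      + (\<Sum>j\<le>Suc m. (totD ^^ j) v * (case j of 0 \<Rightarrow> 0 | Suc i \<Rightarrow> dq i F))"
    unfolding evol_eq[OF totD_Q[OF m]] dq_totD[OF assms(2)] by (simp only: distrib_left sum.distrib)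
  also have "(\<Sum>j\<le>Suc m. (totD ^^ j) v * totD (dq j F)) = (\<Sum>j\<le>m. (totD ^^ j) v * totD (dq j F))"
    by (simp add: top)
  also have "(\<Sum>j\<le>Suc m. (totD ^^ j) v * (case j of 0 \<Rightarrow> 0 | Suc i \<Rightarrow> dq i F))
      = (\<Sum>i\<le>m. (totD ^^ Suc i) v * dq i F)"
    by (subst sum.atMost_Suc_shift) simp
  also have "(\<Sum>j\<le>m. (totD ^^ j) v * totD (dq j F)) + (\<Sum>i\<le>m. (totD ^^ Suc i) v * dq i F)
      = totD (evol v F)"
    unfolding evol_eq[OF m] using assms by (simp add: totD_sum QQ_mult totD_mult sum.distrib add.commute)
  finally show ?thesis .
qed

lemma evol_uminus: "F \<in> QQ \<Longrightarrow> evol v (- F) = - evol v F"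
  by (auto simp: QQ_def evol_eq[of F] evol_eq[OF Q_uminus] pd_uminus[OF Q_QQ] sum_negf)

lemma evol_adjD_pow:
  assumes "v \<in> QQ" "F \<in> QQ"
  shows "evol v ((adjD ^^ k) F) = (adjD ^^ k) (evol v F)"
proof (induction k)
  case (Suc k)
  have "evol v ((adjD ^^ Suc k) F) = - evol v (totD ((adjD ^^ k) F))"
    using assms by (simp add: adjD_def evol_uminus)
  also have "\<dots> = (adjD ^^ Suc k) (evol v F)"
    unfolding evol_totD[OF assms(1) adjD_pow_QQ[OF assms(2)]] Suc by (simp add: adjD_def)
  finally show ?case .
qed simp

lemma evol_add:
  assumes "F \<in> QQ" "G \<in> QQ"
  shows "evol v (F + G) = evol v F + evol v G"
proof -
  obtain m where m: "F \<in> Q m" "G \<in> Q m" using QQ_common[OF assms] .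
  show ?thesis
    using assms by (simp add: evol_eq[OF m(1)] evol_eq[OF m(2)] evol_eq[OF Q_add[OF m]] pd_add algebra_simps sum.distrib)
qed

lemma evol_0 [simp]: "evol v 0 = 0"
  by (simp add: evol_def)

lemma evol_sum: "(\<And>i. i \<in> A \<Longrightarrow> F i \<in> QQ) \<Longrightarrow> evol v (sum F A) = (\<Sum>i\<in>A. evol v (F i))"
  by (induction A rule: infinite_finite_induct) (auto simp: evol_add QQ_sum)

lemma dq_totD_pow_x_only:
  assumes "v \<in> QQ" "\<And>j. dq j v = 0"
  shows "dq j ((totD ^^ k) v) = 0"
  by (induction k arbitrary: j) (auto simp: assms dq_totD split: nat.split)

text \<open>
  The assumption on \<open>v\<close> says that it is a function of \<open>x\<close> alone. All \<open>D^j v\<close> are then such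
  functions, so the coefficients of \<open>evol v\<close> are constants for \<open>\<partial>/\<partial>q\<^sub>k\<close>.
\<close>

lemma evol_dq:
  assumes "v \<in> QQ" "\<And>j. dq j v = 0" "F \<in> QQ"
  shows "evol v (dq k F) = dq k (evol v F)"
proof -
  obtain m where m: "F \<in> Q m" using assms by (auto simp: QQ_def)
  have "dq k (evol v F) = (\<Sum>j\<le>m. (totD ^^ j) v * dq k (dq j F))"
    unfolding evol_eq[OF m] using assms
    by (simp add: pd_sum QQ_mult pd_mult dq_totD_pow_x_only)
  also have "\<dots> = evol v (dq k F)"
    unfolding evol_eq[OF pd_Q[OF m]] by (simp add: pd_commute[OF assms(3), of "Some k"])
  finally show ?thesis ..
qed

lemma evol_Euler:
  assumes v: "v \<in> QQ" "\<And>j. dq j v = 0" and F: "F \<in> QQ"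
  shows "evol v (Euler F) = Euler (evol v F)"
proof -
  obtain m where m: "F \<in> Q m" "evol v F \<in> Q m"
    using QQ_common[OF F evol_QQ[OF F v(1)]] .
  show ?thesis
    unfolding Euler_eq[OF m(1)] Euler_eq[OF m(2)]
    using v F by (simp add: evol_sum evol_adjD_pow evol_dq)
qed

text \<open>
  The Helmholtz condition: the linearisation of an Euler-Lagrange expression, here applied to
  functions \<open>v\<close> of \<open>x\<close>, equals its formal adjoint.
\<close>

lemma evol_Euler_self_adjoint:
  assumes v: "v \<in> QQ" "\<And>j. dq j v = 0" and F: "F \<in> QQ"
  shows "evol v (Euler F) = Euler (v * Euler F)"
proof -
  obtain G where G: "G \<in> QQ" "evol v F = v * Euler F + totD G" using evol_by_parts v F by blast
  then show ?thesis
    using v F by (simp add: evol_Euler Euler_add Euler_totD QQ_mult)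
qed

section \<open>Odd orders\<close>

definition x_minus :: "real \<Rightarrow> jet \<Rightarrow> real" where
  "x_minus a = var None + const (- a)"

lemma x_minus_Q [simp]: "x_minus a \<in> Q m"
  unfolding x_minus_def by (intro Q_add var_Q const_Q)

lemma x_minus_QQ [simp]: "x_minus a \<in> QQ"
  using Q_QQ[OF x_minus_Q] .

lemma const_at: "p \<in> J \<Longrightarrow> const a p = a"
  by (simp add: const_def)

lemma x_minus_at [simp]: "p \<in> J \<Longrightarrow> x_minus a p = fst p - a"
  by (simp add: x_minus_def var_def const_def pointwise)

lemma dq_x_minus: "dq j (x_minus a) = 0"
  by (simp add: x_minus_def pd_add pd_var)

lemma totD_x_minus: "totD (x_minus a) = const 1"
  by (simp add: totD_eq[OF x_minus_Q[of a 0]] dq_x_minus) (simp add: x_minus_def pd_add pd_var)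

lemma x_minus_pow_QQ [simp]: "g \<in> QQ \<Longrightarrow> x_minus a ^ m * g \<in> QQ"
  by (induction m) (auto simp: mult.assoc QQ_mult)

lemma dq_x_minus_pow: "g \<in> QQ \<Longrightarrow> dq j (x_minus a ^ m * g) = x_minus a ^ m * dq j g"
  by (induction m) (auto simp: mult.assoc pd_mult dq_x_minus)

text \<open>
  Each total derivative lowers the order of vanishing at \<open>x = a\<close> by one. Only the value of the
  cofactor \<open>g'\<close> at \<open>x = a\<close> matters afterwards, since all later evaluations take place there.
\<close>

lemma totD_x_minus_pow:
  assumes "g \<in> QQ"
  shows "\<exists>g'\<in>QQ. totD (x_minus a ^ Suc m * g) = x_minus a ^ m * g' \<and>
           (\<forall>p\<in>J. fst p = a \<longrightarrow> g' p = real (Suc m) * g p)"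
proof (induction m)
  case 0
  have "totD (x_minus a * g) = g + x_minus a * totD g"
    using assms by (simp add: totD_mult totD_x_minus)
  moreover have "(g + x_minus a * totD g) p = g p" if "p \<in> J" "fst p = a" for p
    using that by (simp add: pointwise)
  ultimately show ?case
    by (intro bexI[of _ "g + x_minus a * totD g"]) (use assms in auto)
next
  case (Suc m)
  then obtain g' where g': "g' \<in> QQ" "totD (x_minus a ^ Suc m * g) = x_minus a ^ m * g'"
    "\<And>p. p \<in> J \<Longrightarrow> fst p = a \<Longrightarrow> g' p = real (Suc m) * g p" by blast
  have "totD (x_minus a ^ Suc (Suc m) * g) = totD (x_minus a * (x_minus a ^ Suc m * g))"
    by (simp add: mult.assoc)
  also have "\<dots> = x_minus a ^ Suc m * g + x_minus a * (x_minus a ^ m * g')"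
    using assms g' by (subst totD_mult) (auto simp: totD_x_minus simp del: power_Suc)
  also have "\<dots> = x_minus a ^ Suc m * (g + g')" by (simp add: algebra_simps)
  finally have "totD (x_minus a ^ Suc (Suc m) * g) = x_minus a ^ Suc m * (g + g')" .
  moreover have "(g + g') p = real (Suc (Suc m)) * g p" if "p \<in> J" "fst p = a" for p
    using g'(3)[OF that] by (simp add: pointwise algebra_simps)
  ultimately show ?case using assms g'(1) by (intro bexI[of _ "g + g'"]) auto
qed

lemma totD_pow_x_minus_pow:
  assumes "g \<in> QQ" "k \<le> m" "p \<in> J" "fst p = a"
  shows "(totD ^^ k) (x_minus a ^ m * g) p = (if k < m then 0 else fact m * g p)"
  using assms(1,2)
proof (induction k arbitrary: m g)
  case 0
  then show ?case using assms(3,4) by (cases m) (auto simp: pointwise)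
next
  case (Suc k)
  then obtain n where n: "m = Suc n" "k \<le> n" by (cases m) auto
  obtain g' where g': "g' \<in> QQ" "totD (x_minus a ^ Suc n * g) = x_minus a ^ n * g'"
    "g' p = real (Suc n) * g p" using totD_x_minus_pow[OF Suc.prems(1)] assms(3,4) by blast
  have "(totD ^^ Suc k) (x_minus a ^ m * g) p = (totD ^^ k) (x_minus a ^ n * g') p"
    by (simp only: funpow_Suc_right o_apply n(1) g'(2))
  also have "\<dots> = (if k < n then 0 else fact n * g' p)"
    by (rule Suc.IH) (use g' n in auto)
  finally show ?case using n g' by (simp add: algebra_simps)
qed

text \<open>
  Self-adjointness, tested on \<open>v = (x - a)^m\<close> at a point over \<open>a\<close>: the order of vanishing of \<open>v\<close>
  removes every term except the one with all \<open>m\<close> derivatives on \<open>v\<close>, on both sides.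
\<close>

lemma Euler_top_symbol:
  assumes F: "F \<in> QQ" and s: "Euler F \<in> Q m" and "odd m"
  shows "dq m (Euler F) = 0"
proof
  fix p
  show "dq m (Euler F) p = 0 p"
  proof (cases "p \<in> J")
    case True
    define a where "a = fst p"
    \<comment> \<open>The factor \<open>const 1\<close> brings \<open>v\<close> into the form \<open>x_minus a ^ m * g\<close> of the preceding lemmas.\<close>
    define v where "v = x_minus a ^ m * const 1"
    let ?s = "Euler F"
    have a: "fst p = a" by (simp add: a_def)
    have v: "v \<in> QQ" "\<And>j. dq j v = 0" by (simp_all add: v_def dq_x_minus_pow)
    have sQ: "?s \<in> QQ" by (rule Q_QQ[OF s])
    have "v \<in> Q m"
    proof -
      have "x_minus a ^ k * const 1 \<in> Q m" for k
        by (induction k) (auto simp: mult.assoc intro: Q_mult)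
      then show ?thesis by (simp add: v_def)
    qed
    then have vs: "v * ?s \<in> Q m" by (rule Q_mult[OF _ s])
    have "evol v ?s p = (\<Sum>j\<le>m. (totD ^^ j) v p * dq j ?s p)"
      by (simp add: evol_eq[OF s] sum_apply times_fun_apply)
    also have "\<dots> = (\<Sum>j\<le>m. if m = j then fact m * dq m ?s p else 0)"
      by (rule sum.cong) (use True in \<open>auto simp: v_def totD_pow_x_minus_pow[OF _ _ True a] const_at pointwise\<close>)
    finally have lhs: "evol v ?s p = fact m * dq m ?s p" by simp
    have "Euler (v * ?s) p = (\<Sum>k\<le>m. (adjD ^^ k) (v * dq k ?s) p)"
      by (simp add: Euler_eq[OF vs] sum_apply pd_mult[OF v(1) sQ] v(2))
    also have "\<dots> = (\<Sum>k\<le>m. if m = k then - (fact m * dq m ?s p) else 0)"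
    proof (rule sum.cong)
      fix k assume k: "k \<in> {..m}"
      have "v * dq k ?s = x_minus a ^ m * dq k ?s" using sQ by (simp add: v_def mult.assoc)
      then show "(adjD ^^ k) (v * dq k ?s) p = (if m = k then - (fact m * dq m ?s p) else 0)"
        using k sQ \<open>odd m\<close>
        by (auto simp: pointwise adjD_pow_sign totD_pow_x_minus_pow[OF _ _ True a])
    qed simp
    finally have "Euler (v * ?s) p = - (fact m * dq m ?s p)" by simp
    then have "fact m * dq m ?s p = - (fact m * dq m ?s p)"
      using lhs evol_Euler_self_adjoint[OF v F] by simp
    then show ?thesis by (simp add: pointwise)
  qed (simp add: pd_out pointwise)
qed

section \<open>Even orders\<close>

lemma var_0_inv: "var (Some 0) * inv_q0 = const 1"
proof
  fix p show "(var (Some 0) * inv_q0) p = const 1 p"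
    using q0_pos[of p] by (cases "p \<in> J") (simp_all add: var_def inv_q0_def const_def pointwise)
qed

lemma totD_pow_var: "(totD ^^ j) (var (Some 0)) = var (Some j)"
proof (induction j)
  case (Suc j)
  have "totD (var (Some j)) = var (Some (Suc j))"
    by (simp add: totD_eq[OF var_Q(1)] pd_var if_distrib[of "\<lambda>x. _ * x"] sum.delta cong: if_cong)
  then show ?case using Suc by simp
qed simp

text \<open>
  For \<open>n = 1\<close> this is the density \<open>q\<^sub>1\<^sup>2 / q\<^sub>0\<close> of the Fisher information.
\<close>

definition fisher :: "nat \<Rightarrow> jet \<Rightarrow> real" where
  "fisher n = var (Some n) * var (Some n) * inv_q0"

lemma fisher_Q: "fisher n \<in> Q n"
  unfolding fisher_def by (intro Q_mult var_Q inv_q0_Q)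

lemma inv_q0_QQ [simp]: "inv_q0 \<in> QQ"
  using Q_QQ[OF inv_q0_Q] .

lemma dq_fisher:
  assumes "0 < n"
  shows "dq j (fisher n) =
    (if j = 0 then - (var (Some n) * var (Some n) * (inv_q0 * inv_q0))
     else if j = n then var (Some n) * inv_q0 + var (Some n) * inv_q0 else 0)"
  using assms by (auto simp: fisher_def pd_mult pd_var pd_inv_q0 QQ_mult algebra_simps)

text \<open>
  Euler's relation for a function homogeneous of degree one in the \<open>q\<^sub>j\<close>. Here \<open>n > 0\<close> keeps the
  two variables \<open>q\<^sub>0\<close> and \<open>q\<^sub>n\<close> apart.
\<close>

lemma evol_fisher:
  assumes "0 < n"
  shows "evol (var (Some 0)) (fisher n) = fisher n"
proof -
  have "evol (var (Some 0)) (fisher n) = (\<Sum>j\<le>n. var (Some j) * dq j (fisher n))"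
    by (simp add: evol_eq[OF fisher_Q] totD_pow_var)
  also have "\<dots> = (\<Sum>j\<in>{0, n}. var (Some j) * dq j (fisher n))"
    by (rule sum.mono_neutral_right) (use assms in \<open>auto simp: dq_fisher\<close>)
  also have "\<dots> = var (Some 0) * dq 0 (fisher n) + var (Some n) * dq n (fisher n)"
    using assms by simp
  also have "\<dots> = - ((var (Some 0) * inv_q0) * (var (Some n) * var (Some n) * inv_q0)) + (fisher n + fisher n)"
    unfolding dq_fisher[OF assms] using assms by (simp add: fisher_def algebra_simps)
  also have "\<dots> = fisher n"
    unfolding var_0_inv using Q_QQ[OF fisher_Q] by (simp add: fisher_def[symmetric])
  finally show ?thesis .
qed

text \<open>
  In \<open>dq_totD\<close> the first term vanishes when \<open>j\<close> exceeds the order of the function, so the top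
  derivative is merely passed down, up to sign, one order at a time.
\<close>

lemma dq_top_adjD_pow:
  assumes "F \<in> Q m"
  shows "dq (m + k) ((adjD ^^ k) F) = (if even k then dq m F else - dq m F)"
proof (induction k)
  case (Suc k)
  have Q: "(adjD ^^ k) F \<in> Q (m + k)" using assms by (rule adjD_pow_Q)
  have "dq (m + Suc k) ((adjD ^^ Suc k) F) = - dq (Suc (m + k)) (totD ((adjD ^^ k) F))"
    using Q_QQ[OF Q] by (simp add: adjD_def pd_uminus)
  also have "\<dots> = - dq (m + k) ((adjD ^^ k) F)"
    using pd_above[OF Q, of "Suc (m + k)"] by (simp add: dq_totD[OF Q_QQ[OF Q]])
  finally show ?case using Suc by simp
qed simp

lemma Euler_fisher_Q: "Euler (fisher n) \<in> Q (2 * n)"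
  unfolding Euler_eq[OF fisher_Q]
proof (rule Q_sum)
  fix k assume "k \<in> {..n}"
  then show "(adjD ^^ k) (dq k (fisher n)) \<in> Q (2 * n)"
    by (intro Q_mono[OF adjD_pow_Q[OF pd_Q[OF fisher_Q]]]) auto
qed

lemma dq_Euler_fisher:
  assumes "0 < n" "p \<in> J"
  shows "dq (2 * n) (Euler (fisher n)) p \<noteq> 0"
proof -
  let ?F = "fisher n"
  have "Euler ?F = (\<Sum>k\<in>{0, n}. (adjD ^^ k) (dq k ?F))"
    unfolding Euler_eq[OF fisher_Q]
    by (rule sum.mono_neutral_right) (use assms in \<open>auto simp: dq_fisher\<close>)
  then have "Euler ?F = dq 0 ?F + (adjD ^^ n) (dq n ?F)" using assms by simp
  then have "dq (2 * n) (Euler ?F) = dq (2 * n) (dq 0 ?F) + dq (2 * n) ((adjD ^^ n) (dq n ?F))"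
    using Q_QQ[OF fisher_Q] by (simp add: pd_add)
  also have "dq (2 * n) (dq 0 ?F) = 0"
    by (rule pd_above[OF pd_Q[OF fisher_Q]]) (use assms in simp)
  also have "dq (2 * n) ((adjD ^^ n) (dq n ?F)) = (if even n then dq n (dq n ?F) else - dq n (dq n ?F))"
    using dq_top_adjD_pow[OF pd_Q[OF fisher_Q[of n], of "Some n"], of n] by (simp add: mult_2)
  finally have "dq (2 * n) (Euler ?F) p = (if even n then dq n (dq n ?F) p else - dq n (dq n ?F) p)"
    by (simp add: pointwise)
  moreover have "dq n (dq n ?F) = inv_q0 + inv_q0"
  proof -
    have "dq n (dq n ?F) = dq n (var (Some n) * inv_q0) + dq n (var (Some n) * inv_q0)"
      using assms by (subst pd_add[symmetric]) (auto simp: dq_fisher)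
    also have "dq n (var (Some n) * inv_q0) = inv_q0"
      using assms by (simp add: pd_mult pd_var pd_inv_q0)
    finally show ?thesis .
  qed
  moreover have "0 < (inv_q0 + inv_q0) p"
    using q0_pos[OF assms(2)] assms(2) unfolding plus_fun_apply by (simp add: inv_q0_def)
  ultimately show ?thesis by simp
qed


section \<open>Curried q-functions\<close>

lemma partial_case_prod:
  "partial None (case_prod f) = case_prod (pd_x f)"
  "partial (Some j) (case_prod f) = case_prod (pd_q j f)"
  by (auto simp: partial_def pd_x_def pd_q_def fun_eq_iff)

lemma Cn_case_prod: "Cn n (case_prod f) \<longleftrightarrow> (\<forall>k\<le>n. Ck_on X k f)"
proof (induction n arbitrary: f)
  case (Suc n)
  have diff: "(\<forall>c. \<forall>p\<in>J. (\<lambda>t. case_prod f (set_coord c t p)) field_differentiable at (coord c p)) \<longleftrightarrow>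
      (\<forall>(x, q)\<in>J. (\<lambda>t. f t q) field_differentiable at x \<and>
        (\<forall>j. (\<lambda>t. f x (q(j := t))) field_differentiable at (q j)))"
    unfolding split_option_all by (auto simp: case_prod_beta)
  have "Cn (Suc n) (case_prod f) \<longleftrightarrow> Ck_on X 0 f \<and> (\<forall>k\<le>n. Ck_on X (Suc k) f)"
    unfolding Cn.simps diff unfolding split_option_all partial_case_prod Suc.IH Ck_on.simps
    using le0[of n] by blast
  also have "\<dots> \<longleftrightarrow> (\<forall>k\<le>Suc n. Ck_on X k f)"
    by (metis Suc_le_mono le0 not0_implies_Suc)
  finally show ?case .
qed simp

lemma dep_case_prod: "dep m (case_prod f) \<longleftrightarrow> depends_upto X m f"
proof
  assume dep: "dep m (case_prod f)"
  show "depends_upto X m f"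
    unfolding depends_upto_def
  proof (intro allI impI)
    fix x q q' assume "(x, q) \<in> J" "(x, q') \<in> J" "\<forall>j\<le>m. q j = q' j"
    then show "f x q = f x q'"
      using dep[unfolded dep_def, rule_format, of "(x, q)" "(x, q')"] by simp
  qed
next
  assume dep: "depends_upto X m f"
  show "dep m (case_prod f)"
    unfolding dep_def
  proof (intro ballI impI)
    fix p p' assume p: "p \<in> J" "p' \<in> J" "fst p = fst p'" "\<forall>j\<le>m. snd p j = snd p' j"
    moreover obtain x q q' where "p = (x, q)" "p' = (x, q')" using p(3) by (cases p; cases p') auto
    ultimately show "case_prod f p = case_prod f p'"
      using dep[unfolded depends_upto_def, rule_format, of x q q'] by simp
  qed
qed

lemma res_in_Q_iff: "res F \<in> Q m \<longleftrightarrow> dep m F \<and> (\<forall>n. Cn n F)"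
proof
  assume Q: "res F \<in> Q m"
  have "Cn n F" for n by (rule Cn_cong[OF _ Q_Cn[OF Q]]) simp
  moreover have "dep m F"
    unfolding dep_def
  proof (intro ballI impI)
    fix p q assume pq: "p \<in> J" "q \<in> J" "fst p = fst q" "\<forall>j\<le>m. snd p j = snd q j"
    then have "res F p = res F q" using Q_dep[OF Q] unfolding dep_def by blast
    then show "F p = F q" using pq by simp
  qed
  ultimately show "dep m F \<and> (\<forall>n. Cn n F)" by simp
qed (simp add: res_in_Q)

lemma q_function_of_order_iff: "q_function_of_order X m f \<longleftrightarrow> res (case_prod f) \<in> Q m"
  unfolding q_function_of_order_def res_in_Q_iff dep_case_prod Cn_case_prod by auto

lemma q_function_iff: "q_function X f \<longleftrightarrow> res (case_prod f) \<in> QQ"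
  unfolding q_function_def q_function_of_order_iff QQ_def by auto

text \<open>
  The curried operators act on functions with arbitrary values off \<open>J\<close>, the operators above on
  normalised ones; this relation connects the two.
\<close>

definition agrees :: "(real \<Rightarrow> (nat \<Rightarrow> real) \<Rightarrow> real) \<Rightarrow> (jet \<Rightarrow> real) \<Rightarrow> bool" where
  "agrees f F \<longleftrightarrow> (\<forall>x q. (x, q) \<in> J \<longrightarrow> f x q = F (x, q))"

lemma partial_agrees:
  assumes "agrees f F" "p \<in> J"
  shows "partial c (case_prod f) p = pd c F p"
proof -
  have "partial c (case_prod f) p = partial c F p"
    by (rule partial_cong) (use assms in \<open>auto simp: agrees_def\<close>)
  then show ?thesis using assms by (simp add: pd_def)
qed

lemma pd_x_agrees: "agrees f F \<Longrightarrow> agrees (pd_x f) (pd None F)"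
  using partial_agrees[of f F _ None] by (auto simp: agrees_def partial_case_prod)

lemma pd_q_agrees: "agrees f F \<Longrightarrow> agrees (pd_q j f) (dq j F)"
  using partial_agrees[of f F _ "Some j"] by (auto simp: agrees_def partial_case_prod)

lemma total_D_agrees:
  assumes "agrees f F" "F \<in> QQ"
  shows "agrees (total_D f) (totD F)"
  unfolding agrees_def
proof (intro allI impI)
  fix x q assume p: "(x, q) \<in> J"
  obtain m where m: "F \<in> Q m" using assms(2) by (auto simp: QQ_def)
  have dq: "pd_q j f x q = dq j F (x, q)" for j
    using pd_q_agrees[OF assms(1)] p by (simp add: agrees_def)
  have "(\<Sum>j. q (Suc j) * pd_q j f x q) = (\<Sum>j\<le>m. q (Suc j) * pd_q j f x q)"
    by (rule suminf_finite) (auto simp: dq pd_above[OF m] zero_fun_apply)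
  moreover have "pd_x f x q = pd None F (x, q)"
    using pd_x_agrees[OF assms(1)] p by (simp add: agrees_def)
  ultimately show "total_D f x q = totD F (x, q)"
    using p by (simp add: total_D_def totD_eq[OF m] pointwise sum_apply dq var_def)
qed

lemma total_D_pow_agrees:
  assumes "agrees f F" "F \<in> QQ"
  shows "agrees ((total_D ^^ k) f) ((totD ^^ k) F)"
proof (induction k)
  case (Suc k)
  then show ?case using total_D_agrees assms(2) by simp
qed (simp add: assms)

text \<open>
  In \<open>Euler (q\<^sub>0 F)\<close> the product rule produces the terms of \<open>key_L\<close> and, from differentiating the
  factor \<open>q\<^sub>0\<close> itself in the summand \<open>k = 0\<close>, one additional \<open>F\<close>.
\<close>

lemma key_L_eq:
  assumes f: "agrees f F" and F: "F \<in> QQ" and p: "(x, q) \<in> J"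
  shows "key_L f x q = F (x, q) - Euler (var (Some 0) * F) (x, q)"
proof -
  obtain m where m: "F \<in> Q m" using F by (auto simp: QQ_def)
  let ?g = "\<lambda>k. var (Some 0) * dq k F"
  have uF: "var (Some 0) * F \<in> Q m" by (rule Q_mult[OF Q_mono[OF var_Q(1)] m]) simp
  have "agrees (\<lambda>y r. r 0 * pd_q k f y r) (?g k)" for k
    using pd_q_agrees[OF f, of k] by (simp add: agrees_def var_def times_fun_apply)
  then have "agrees ((total_D ^^ k) (\<lambda>y r. r 0 * pd_q k f y r)) ((totD ^^ k) (?g k))" for k
    by (rule total_D_pow_agrees) (use F in simp)
  then have D: "(total_D ^^ k) (\<lambda>y r. r 0 * pd_q k f y r) x q = (totD ^^ k) (?g k) (x, q)" for k
    using p by (simp add: agrees_def)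
  have signed: "(-1) ^ (k + 1) * (totD ^^ k) (?g k) (x, q) = - (adjD ^^ k) (?g k) (x, q)" for k
    using F by (simp add: adjD_pow_sign pointwise)
  have "key_L f x q = (\<Sum>k. - (adjD ^^ k) (?g k) (x, q))"
    unfolding key_L_def D signed ..
  also have "\<dots> = (\<Sum>k\<le>m. - (adjD ^^ k) (?g k) (x, q))"
    by (rule suminf_finite) (auto simp: pd_above[OF m] zero_fun_apply)
  finally have key: "key_L f x q = - (\<Sum>k\<le>m. (adjD ^^ k) (?g k) (x, q))" by (simp add: sum_negf)
  have "(adjD ^^ k) (dq k (var (Some 0) * F)) = (if k = 0 then F else 0) + (adjD ^^ k) (?g k)" for k
    using F by (auto simp: pd_mult pd_var adjD_pow_add)
  then have "Euler (var (Some 0) * F) = F + (\<Sum>k\<le>m. (adjD ^^ k) (?g k))"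
    by (simp add: Euler_eq[OF uF] sum.distrib)
  then show ?thesis by (simp add: key pointwise sum_apply)
qed

lemma key_local_score_iff:
  "key_local_score X f \<longleftrightarrow> res (case_prod f) \<in> QQ \<and>
     Euler (var (Some 0) * res (case_prod f)) = res (case_prod f)"
proof (cases "res (case_prod f) \<in> QQ")
  case True
  let ?F = "res (case_prod f)"
  have "agrees f ?F" by (simp add: agrees_def)
  then have "key_local_score X f \<longleftrightarrow> (\<forall>p\<in>J. ?F p = Euler (var (Some 0) * ?F) p)"
    using True key_L_eq[of f ?F]
    by (simp add: key_local_score_def q_function_iff case_prod_beta)
  also have "\<dots> \<longleftrightarrow> (\<forall>p. ?F p = Euler (var (Some 0) * ?F) p)"
  proof -
    have "?F p = Euler (var (Some 0) * ?F) p" if "p \<notin> J" for p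
      using QQ_out[OF True that] QQ_out[OF Euler_QQ that, of "var (Some 0) * ?F"] True by simp
    then show ?thesis by blast
  qed
  finally show ?thesis using True by (auto simp: fun_eq_iff)
qed (simp add: key_local_score_def q_function_iff)

lemma depends_upto_imp_dq_0:
  assumes "depends_upto X n f" "n < m"
  shows "dq m (res (case_prod f)) = 0"
proof
  fix p
  show "dq m (res (case_prod f)) p = 0 p"
  proof (cases "p \<in> J")
    case True
    have "agrees f (res (case_prod f))" by (simp add: agrees_def)
    then have "dq m (res (case_prod f)) p = partial (Some m) (case_prod f) p"
      using partial_agrees True by simp
    also have "\<dots> = 0"
      using assms by (intro partial_above_dep[OF _ True]) (auto simp: dep_case_prod)
    finally show ?thesis by (simp add: zero_fun_apply)
  qed (simp add: pd_out zero_fun_apply)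
qed

text \<open>
  The variable \<open>q\<^sub>n\<^sub>+\<^sub>1\<close> ranges over the whole line, so a vanishing derivative along it makes the
  function constant in it.
\<close>

lemma dq_0_imp_depends_upto:
  assumes F: "res (case_prod f) \<in> Q (Suc n)" and zero: "dq (Suc n) (res (case_prod f)) = 0"
  shows "depends_upto X n f"
  unfolding depends_upto_def
proof (intro allI impI)
  fix x q q' assume xq: "(x, q) \<in> J" "(x, q') \<in> J" and eq: "\<forall>j\<le>n. q j = q' j"
  let ?F = "res (case_prod f)"
  let ?g = "\<lambda>t. ?F (x, q(Suc n := t))"
  have inJ: "(x, q(Suc n := t)) \<in> J" for t using xq by (simp add: qdom_def)
  have "(?g has_field_derivative 0) (at t)" for t
    using has_pd[OF Q_QQ[OF F] inJ, of "Some (Suc n)" t] by (simp add: zero zero_fun_apply)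
  then have "?g (q (Suc n)) = ?g (q' (Suc n))"
    using DERIV_isconst_all[of ?g] by blast
  then have "?F (x, q) = ?F (x, q(Suc n := q' (Suc n)))" by simp
  also have "\<dots> = ?F (x, q')"
    by (rule Q_dep[OF F, unfolded dep_def, rule_format, OF inJ xq(2)]) (use eq in \<open>auto simp: le_Suc_eq\<close>)
  finally show "f x q = f x q'" using xq by simp
qed

end

theorem mainTheorem3:
  fixes X :: "real set"
  assumes "open X" and "is_interval X" and "X \<noteq> {}"
  shows "(\<forall>m::nat. 0 < m \<and> even m \<longrightarrow> (\<exists>s. key_local_score X s \<and> exact_order X m s)) \<and>
         (\<forall>m::nat. 0 < m \<and> odd m \<longrightarrow> \<not> (\<exists>s. key_local_score X s \<and> exact_order X m s))"
proof -
  interpret jets X by unfold_locales (rule assms(1))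
  have "\<exists>s. key_local_score X s \<and> exact_order X m s" if m: "0 < m" "even m" for m
  proof -
    obtain n where n: "m = 2 * n" "0 < n" using m by (auto elim: evenE)
    define S where "S = Euler (fisher n)"
    have SQ: "S \<in> Q m" unfolding S_def n by (rule Euler_fisher_Q)
    have res: "res (case_prod (curry S)) = S"
    proof
      show "res (case_prod (curry S)) p = S p" for p
        using Q_out[OF SQ, of p] by (cases "p \<in> J") simp_all
    qed
    have "key_local_score X (curry S)"
      unfolding key_local_score_iff res
      using Q_QQ[OF SQ] Euler_homogeneous[OF var_QQ Q_QQ[OF fisher_Q] evol_fisher[OF n(2)]]
      by (simp add: S_def)
    moreover have "\<not> depends_upto X (m - 1) (curry S)"
    proof
      assume "depends_upto X (m - 1) (curry S)"
      then have "dq m S = 0" using depends_upto_imp_dq_0[of "m - 1" "curry S" m] m res by simp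
      moreover obtain x where "x \<in> X" using assms(3) by blast
      then have "(x, \<lambda>_. 1) \<in> J" by (simp add: qdom_def)
      ultimately show False using dq_Euler_fisher[OF n(2)] by (simp add: S_def n zero_fun_apply)
    qed
    moreover have "q_function_of_order X m (curry S)"
      unfolding q_function_of_order_iff res by (rule SQ)
    ultimately show ?thesis
      using m by (intro exI[of _ "curry S"]) (simp add: exact_order_def)
  qed
  moreover have False if m: "odd m" and s: "key_local_score X s" "exact_order X m s" for m s
  proof -
    let ?S = "res (case_prod s)"
    obtain n where n: "m = Suc n" using m by (cases m) auto
    have S: "?S \<in> QQ" "Euler (var (Some 0) * ?S) = ?S" using s(1) by (simp_all add: key_local_score_iff)
    have SQ: "?S \<in> Q m" using s(2) by (simp add: exact_order_def q_function_of_order_iff)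
    have "dq m ?S = 0"
      using Euler_top_symbol[of "var (Some 0) * ?S" m] S SQ m by simp
    then have "depends_upto X n s" using SQ unfolding n by (intro dq_0_imp_depends_upto)
    then show False using s(2) by (simp add: exact_order_def n)
  qed
  ultimately show ?thesis by blast
qed

end
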